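(* For every real number $\lambda_0<\frac{3}{\sqrt{2}}$ there exist constants $C_{\lambda_0}$ and $C'_{\lambda_0}$, depending only on $\lambda_0$, such that the following holds. Let $\alpha\in(0,1)$, put $\lambda=\frac{1-\alpha}{2\alpha}$, let $\kappa=\kappa(\lambda)$ be the spectral radius order of $\lambda$, and suppose that $\lambda\leq\lambda_0$. (a) If $\kappa<\infty$, then $N_{\alpha}(d)=\left\lfloor \frac{(d-1)\kappa}{\kappa-1}\right\rfloor$ for every positive integer $d>C_{\lambda_0}\kappa$. (b) If $\kappa=\infty$, then $N_{\alpha}(d)=d+O_{\lambda_0}(1)$, that is, $|N_{\alpha}(d)-d|\leq C'_{\lambda_0}$ for every positive integer $d$.
   Context: A collection of lines through the origin in $\mathbb{R}^d$ is called equiangular if the angle between any two distinct lines of the collection is the same. For $\alpha\in(0,1)$, $N_\alpha(d)$ denotes the maximum number of equiangular lines in $\mathbb{R}^d$ with common angle $\arccos\alpha$ (equivalently, the maximum number of lines spanned by unit vectors with $|\langle u,v\rangle|=\alpha$ for any two unit vectors $u,v$ spanning distinct lines). All graphs are finite, simple and undirected. For a graph $G$, $\lambda_1(G)$ is the largest eigenvalue of its adjacency matrix. For a real number $\lambda$, the spectral radius order $\kappa(\lambda)$ is the smallest integer $n$ such that there exists a graph $G$ with exactly $n$ vertices and $\lambda_1(G)=\lambda$; if no graph $G$ satisfies $\lambda_1(G)=\lambda$, then $\kappa(\lambda)=\infty$. *)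

theory Defs
  imports
    Complex_Main
    "HOL-Library.Extended_Nat"
    "Jordan_Normal_Form.Spectral_Radius"
    "Graph_Theory.Pair_Digraph"
begin

text \<open>
  The dimension varies inside the statements below, so Euclidean d-space is the carrier
  \<^term>\<open>carrier_vec d\<close> of real vectors, with \<^const>\<open>scalar_prod\<close> as inner product.
\<close>

definition line_through :: "real vec \<Rightarrow> real vec set" where
  "line_through v = range (\<lambda>c. c \<cdot>\<^sub>v v)"

definition lines_through_origin :: "nat \<Rightarrow> real vec set set" where
  "lines_through_origin d = line_through ` (carrier_vec d - {0\<^sub>v d})"

text \<open>
  Every line contains exactly two unit vectors, which differ by a sign, so the angle
  between two lines does not depend on the unit vectors chosen on them.
\<close>

definition equiangular_lines :: "nat \<Rightarrow> real \<Rightarrow> real vec set set \<Rightarrow> bool" where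
  "equiangular_lines d \<theta> L \<longleftrightarrow>
     L \<subseteq> lines_through_origin d \<and>
     (\<forall>l\<in>L. \<forall>m\<in>L. l \<noteq> m \<longrightarrow>
        (\<forall>u\<in>l. \<forall>v\<in>m. scalar_prod u u = 1 \<longrightarrow> scalar_prod v v = 1 \<longrightarrow>
           arccos \<bar>scalar_prod u v\<bar> = \<theta>))"

text \<open>
  For \<^term>\<open>\<alpha> \<in> {0<..<1::real}\<close> the maximum is over a finite set (there are at most
  d(d+1)/2 equiangular lines in d-space), which is nonempty because of the empty collection.
\<close>

definition max_equiangular :: "real \<Rightarrow> nat \<Rightarrow> nat" where
  "max_equiangular \<alpha> d = Max {card L | L. finite L \<and> equiangular_lines d (arccos \<alpha>) L}"

text \<open>
  A \<^const>\<open>pair_graph\<close> is a finite symmetric digraph without loops or parallel arcs, that is,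
  a finite simple undirected graph. Up to isomorphism, the vertex set of a graph with n
  vertices is \<^term>\<open>{..<n}\<close>, so that the rows and columns of the adjacency matrix are the vertices.
\<close>

definition adjacency_matrix :: "nat \<Rightarrow> nat pair_pre_digraph \<Rightarrow> real mat" where
  "adjacency_matrix n G = mat n n (\<lambda>(i, j). if (i, j) \<in> parcs G then 1 else 0)"

definition largest_eigenvalue :: "nat \<Rightarrow> nat pair_pre_digraph \<Rightarrow> real" where
  "largest_eigenvalue n G = Max (spectrum (adjacency_matrix n G))"

text \<open>
  The null graph is excluded, since its adjacency matrix has no eigenvalues.
  The infimum of the empty set of extended naturals is \<^term>\<open>\<infinity> :: enat\<close>.
\<close>

definition spectral_radius_order :: "real \<Rightarrow> enat" where
  "spectral_radius_order r =
     Inf {enat n | n. n \<ge> 1 \<and>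
       (\<exists>G. pair_graph G \<and> pverts G = {..<n} \<and> largest_eigenvalue n G = r)}"

end

theory Submission
  imports
    Defs
    "HOL-Library.Ramsey"
    "HOL-Analysis.Function_Topology"
    "HOL-Analysis.Convex"
begin

text \<open>
  \<^bold>\<open>From lines to a graph.\<close> Choose a unit vector on each of the N lines and join two lines when the
  inner product of their vectors is negative. If A is the adjacency matrix, J the all-ones matrix and
  \<lambda> = (1 - \<alpha>)/(2\<alpha>), then the Gram matrix is 2\<alpha> times \<lambda>I - A + J/2. It is positive semidefinite of
  rank at most d, so N exceeds d by at most the dimension of its kernel. Everything is
  expressed through the quadratic form F(x) = \<lambda>|x|^2 - \<langle>x, Ax\<rangle>, which satisfies F(x) + (\<Sum>x)^2/2 \<ge> 0. The
  kernel is bounded by exhibiting a small \<^emph>\<open>determining set\<close>: a set of vertices such that only the zero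
  vector of the kernel vanishes there (\<open>card_le_of_determining\<close>). Perron-Frobenius theory enters in an
  elementary form: F(|x|) \<le> F(x), and where F is nonnegative a null vector solves the eigenvector
  equation.

  \<^bold>\<open>Bounded degree.\<close> Replacing vectors by their negatives changes the graph but not the lines. Large
  cliques contradict positivity, so for large N Ramsey's theorem yields a large independent set S.
  Every other vertex is joined to few or to almost all of S (\<open>not_both_large\<close>); after a sign
  change it is joined to few, and then all degrees are below an absolute constant
  (\<open>degree_less_25\<close>). The constants are absolute because \<lambda> < 3.

  \<^bold>\<open>The form is nonnegative.\<close> Null vectors of F live on the components whose largest eigenvalue is \<lambda>.
  There, up to a scalar, each is the Perron vector, and vectors in the kernel of the Gram matrix
  have entry sum zero, so m such components give a kernel of dimension at most m - 1
  (\<open>determining_set_of_nonneg\<close>). Each of them has at least \<kappa> vertices, whence m\<kappa> \<le> N and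
  N \<le> d + m - 1; this gives N \<le> (d - 1)\<kappa>/(\<kappa> - 1), or N \<le> d if m = 0.

  \<^bold>\<open>The form takes a negative value.\<close> Positivity of the Gram matrix leaves room for only one
  negative direction: if F(b) < 0, then no nonzero y with F(y) \<le> 0 lives on vertices that are neither
  in the support of b nor adjacent to it (\<open>separated_from_negative\<close>). If b has bounded support, then the
  neighbourhood of the support is a bounded determining set. The hypothesis \<lambda> \<le> lam0 < 3/\<surd>2
  says when this happens: 3/\<surd>2 is the spectral radius of three infinite rays joined at one point, so
  a long enough spider (three paths with a common endpoint) carries such a b
  (\<open>spider_negative\<close>). If there is no long spider, then the layers of any breadth-first search have
  bounded size (\<open>card_layer_le\<close>), because three vertices of a layer whose ancestral paths stay disjoint
  for long would meet in a spider. Grow a breadth-first ball until F becomes negative on it; the last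
  layer and the next one separate the part inside, where F is nonnegative, from the part outside,
  which the ball controls. Together with the root they form a bounded determining set
  (\<open>determining_set_of_layers\<close>). Hence N \<le> d + C.

  \<^bold>\<open>Lower bounds.\<close> For \<kappa> < \<infinity> take a graph H on \<kappa> vertices with largest eigenvalue \<lambda>. For its adjacency matrix B, the
  matrix \<lambda>I - B is positive semidefinite and has a null vector, so it is a Gram matrix in dimension \<kappa> - 1. Orthogonal
  copies of this configuration, isolated vertices, and one common coordinate realise
  \<lfloor>(d - 1)\<kappa>/(\<kappa> - 1)\<rfloor> lines (\<open>many_lines\<close>). For every \<alpha>, d vectors with all inner products equal to \<alpha>
  give d lines.
\<close>

section \<open>Linear systems and Gram matrices\<close>

text \<open>
  Gaussian elimination: an equation with a nonzero coefficient is solved for one unknown, which is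
  then substituted in the others; this uses up one equation and one unknown.
\<close>

lemma nonzero_solution:
  fixes f :: "'j \<Rightarrow> 'i \<Rightarrow> real"
  assumes "finite J" "finite I" "card J < card I"
  shows "\<exists>x. (\<exists>i\<in>I. x i \<noteq> 0) \<and> (\<forall>j\<in>J. (\<Sum>i\<in>I. f j i * x i) = 0)"
  using assms
proof (induction J arbitrary: I f rule: finite_induct)
  case empty
  then have "I \<noteq> {}" by auto
  then show ?case by (intro exI[of _ "\<lambda>_. 1"]) auto
next
  case (insert j0 J)
  show ?case
  proof (cases "\<forall>i\<in>I. f j0 i = 0")
    case True
    have "card J < card I" using insert by simp
    from insert.IH[OF insert.prems(1) this, of f] show ?thesis using True by auto
  next
    case False
    then obtain i0 where i0: "i0 \<in> I" "f j0 i0 \<noteq> 0" by blast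
    let ?I = "I - {i0}"
    define g where "g j i = f j i - f j i0 * f j0 i / f j0 i0" for j i
    have "card J < card ?I" using insert i0 by simp
    then obtain x where x: "\<exists>i\<in>?I. x i \<noteq> 0" "\<forall>j\<in>J. (\<Sum>i\<in>?I. g j i * x i) = 0"
      using insert.IH[of ?I g] insert.prems by auto
    define c where "c = - (\<Sum>i\<in>?I. f j0 i * x i) / f j0 i0"
    define y where "y = x(i0 := c)"
    have split: "(\<Sum>i\<in>I. f j i * y i) = f j i0 * c + (\<Sum>i\<in>?I. f j i * x i)" for j
      using insert.prems(1) i0(1) by (simp add: sum.remove[of I i0] y_def)
    have "(\<Sum>i\<in>I. f j i * y i) = 0" if "j \<in> J" for j
    proof -
      have "0 = (\<Sum>i\<in>?I. g j i * x i)" using x(2) that by simp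
      also have "\<dots> = (\<Sum>i\<in>?I. f j i * x i) - f j i0 / f j0 i0 * (\<Sum>i\<in>?I. f j0 i * x i)"
        unfolding g_def by (simp add: left_diff_distrib right_diff_distrib sum_subtractf sum_distrib_left mult_ac)
      also have "\<dots> = (\<Sum>i\<in>I. f j i * y i)"
        unfolding split c_def by simp
      finally show ?thesis by simp
    qed
    moreover have "(\<Sum>i\<in>I. f j0 i * y i) = 0"
      unfolding split c_def using i0(2) by simp
    moreover have "\<exists>i\<in>I. y i \<noteq> 0"
      using x(1) unfolding y_def by auto
    ultimately show ?thesis by auto
  qed
qed

text \<open>
  Completing the square with respect to the index a: subtracting the rank-one matrix
  M i a * M a j / M a a leaves a positive semidefinite Schur complement on the other indices. If
  M a a = 0, positivity forces the whole row to vanish, and with the convention x / 0 = 0 the same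
  formulas apply.
\<close>

lemma gram_realization:
  fixes M :: "'i \<Rightarrow> 'i \<Rightarrow> real"
  assumes "finite I" and "\<And>i j. M i j = M j i"
    and "\<And>x. 0 \<le> (\<Sum>i\<in>I. \<Sum>j\<in>I. M i j * x i * x j)"
  shows "\<exists>w. \<forall>i\<in>I. \<forall>j\<in>I. (\<Sum>k<card I. w i k * w j k) = M i j"
  using assms
proof (induction I arbitrary: M rule: finite_induct)
  case (insert a I)
  note sym = insert.prems(1) and psd = insert.prems(2)
  \<comment> \<open>positivity on the vector that extends x by the value t at a\<close>
  have ext: "0 \<le> (\<Sum>i\<in>I. \<Sum>j\<in>I. M i j * x i * x j) + 2 * t * (\<Sum>j\<in>I. M a j * x j) + t\<^sup>2 * M a a"
    for x t
  proof -
    define y where "y = x(a := t)"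
    have y: "y a = t" "\<And>i. i \<in> I \<Longrightarrow> y i = x i" unfolding y_def using insert by auto
    have "(\<Sum>i\<in>insert a I. \<Sum>j\<in>insert a I. M i j * y i * y j)
        = M a a * t * t + (\<Sum>j\<in>I. M a j * t * x j) + (\<Sum>i\<in>I. M i a * x i * t)
          + (\<Sum>i\<in>I. \<Sum>j\<in>I. M i j * x i * x j)"
      using insert(1,2) by (simp add: y sum.distrib)
    also have "(\<Sum>i\<in>I. M i a * x i * t) = t * (\<Sum>j\<in>I. M a j * x j)"
      unfolding sum_distrib_left by (intro sum.cong) (auto simp: sym[of _ a])
    also have "(\<Sum>j\<in>I. M a j * t * x j) = t * (\<Sum>j\<in>I. M a j * x j)"
      unfolding sum_distrib_left by (intro sum.cong) auto
    finally show ?thesis using psd[of y] by (simp add: power2_eq_square mult_ac)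
  qed
  define c where "c = M a a"
  have "0 \<le> c" using ext[of "\<lambda>_. 0" 1] unfolding c_def by simp
  \<comment> \<open>with a vanishing diagonal entry the form is linear in t, so its slope is zero\<close>
  have c0: "M a i = 0" if "c = 0" "i \<in> I" for i
  proof (rule ccontr)
    assume ne: "M a i \<noteq> 0"
    define x where "x j = (if j = i then 1 else 0 :: real)" for j
    have "(\<Sum>j\<in>I. M b j * x j) = M b i" for b
      using that insert(1) unfolding x_def
      by (simp add: if_distrib[of "\<lambda>c. _ * c"] sum.delta cong: if_cong)
    moreover have "(\<Sum>b\<in>I. \<Sum>j\<in>I. M b j * x b * x j) = (\<Sum>b\<in>I. (\<Sum>j\<in>I. M b j * x j) * x b)"
      by (simp add: sum_distrib_left mult_ac)
    moreover have "(\<Sum>b\<in>I. M b i * x b) = M i i"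
      using that insert(1) unfolding x_def
      by (simp add: if_distrib[of "\<lambda>c. _ * c"] sum.delta cong: if_cong)
    ultimately have "0 \<le> M i i + 2 * (- (M i i + 1) / (2 * M a i)) * M a i"
      using ext[of x "- (M i i + 1) / (2 * M a i)"] that unfolding c_def by simp
    then show False using ne by (simp add: field_simps)
  qed
  \<comment> \<open>the Schur complement; minimising over t gives its positivity\<close>
  define N where "N i j = M i j - M a i * M a j / c" for i j
  have "0 \<le> (\<Sum>i\<in>I. \<Sum>j\<in>I. N i j * x i * x j)" for x
  proof -
    define b where "b = (\<Sum>j\<in>I. M a j * x j)"
    have "(\<Sum>i\<in>I. \<Sum>j\<in>I. N i j * x i * x j) = (\<Sum>i\<in>I. \<Sum>j\<in>I. M i j * x i * x j) - b * b / c"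
      unfolding N_def b_def sum_product
      by (simp add: left_diff_distrib right_diff_distrib sum_subtractf sum_divide_distrib mult_ac)
    moreover have "0 \<le> (\<Sum>i\<in>I. \<Sum>j\<in>I. M i j * x i * x j) - b * b / c"
      using ext[of x "- b / c"] unfolding b_def[symmetric] c_def[symmetric]
      by (cases "c = 0") (simp_all add: power2_eq_square)
    ultimately show ?thesis by simp
  qed
  moreover have "N i j = N j i" for i j unfolding N_def using sym[of i j] by simp
  ultimately obtain w where w: "\<forall>i\<in>I. \<forall>j\<in>I. (\<Sum>k<card I. w i k * w j k) = N i j"
    using insert.IH[of N] by blast
  define v where "v i k = (if i = a then (if k = card I then sqrt c else 0)
      else if k < card I then w i k else M a i / sqrt c)" for i k
  have card: "card (insert a I) = Suc (card I)" using insert by simp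
  have sq: "sqrt c * sqrt c = c" using \<open>0 \<le> c\<close> by simp
  have "(\<Sum>k<card (insert a I). v i k * v j k) = M i j" if ij: "i \<in> insert a I" "j \<in> insert a I" for i j
  proof -
    have mixed: "(\<Sum>k<Suc (card I). v a k * v i k) = M a i" if "i \<in> I" for i
      using that insert(2) c0[of i] sq by (cases "c = 0") (auto simp: v_def)
    have "(\<Sum>k<Suc (card I). v i k * v j k) = M i j" if "i \<in> I" "j \<in> I"
    proof -
      have "i \<noteq> a" "j \<noteq> a" using that insert(2) by auto
      then have "(\<Sum>k<Suc (card I). v i k * v j k)
          = (\<Sum>k<card I. w i k * w j k) + (M a i / sqrt c) * (M a j / sqrt c)"
        by (simp add: v_def)
      also have "\<dots> = M i j"
        using w that sq by (simp add: N_def)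
      finally show ?thesis .
    qed
    moreover have "(\<Sum>k<Suc (card I). v a k * v a k) = M a a"
      using sq by (simp add: v_def c_def)
    ultimately show ?thesis
      using ij mixed[of i] mixed[of j] sym[of i a] unfolding card by (auto simp: mult.commute)
  qed
  then show ?case by blast
qed simp

text \<open>
  A null vector of M is a linear relation between the vectors to be found. Hence it suffices to
  realise the matrix without the index s and to define the vector at s by this relation.
\<close>

lemma gram_realization_null_vector:
  fixes M :: "'i \<Rightarrow> 'i \<Rightarrow> real"
  assumes fin: "finite I" and sym: "\<And>i j. M i j = M j i"
    and psd: "\<And>x. 0 \<le> (\<Sum>i\<in>I. \<Sum>j\<in>I. M i j * x i * x j)"
    and null: "\<And>i. i \<in> I \<Longrightarrow> (\<Sum>j\<in>I. M i j * y j) = 0" and s: "s \<in> I" "y s \<noteq> 0"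
  shows "\<exists>w. \<forall>i\<in>I. \<forall>j\<in>I. (\<Sum>k<card I - 1. w i k * w j k) = M i j"
proof -
  let ?I = "I - {s}" and ?n = "card I - 1"
  have "0 \<le> (\<Sum>i\<in>?I. \<Sum>j\<in>?I. M i j * x i * x j)" for x
  proof -
    define z where "z i = (if i = s then 0 else x i)" for i
    have "(\<Sum>i\<in>I. \<Sum>j\<in>I. M i j * z i * z j) = (\<Sum>i\<in>?I. \<Sum>j\<in>?I. M i j * z i * z j)"
      using fin s(1) by (simp add: sum.remove[of I s] z_def)
    also have "\<dots> = (\<Sum>i\<in>?I. \<Sum>j\<in>?I. M i j * x i * x j)"
      by (intro sum.cong) (auto simp: z_def)
    finally show ?thesis using psd[of z] by simp
  qed
  then have "\<exists>w. \<forall>i\<in>?I. \<forall>j\<in>?I. (\<Sum>k<card ?I. w i k * w j k) = M i j"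
    using sym fin by (intro gram_realization) auto
  moreover have "card ?I = ?n" using fin s(1) by simp
  ultimately obtain w where w: "\<And>i j. i \<in> ?I \<Longrightarrow> j \<in> ?I \<Longrightarrow> (\<Sum>k<?n. w i k * w j k) = M i j"
    by metis
  define v where "v i k = (if i = s then - (\<Sum>j\<in>?I. y j / y s * w j k) else w i k)" for i k
  have row: "- (\<Sum>j\<in>?I. y j / y s * M i j) = M i s" if "i \<in> I" for i
  proof -
    have "y s * (M i s + (\<Sum>j\<in>?I. y j / y s * M i j)) = M i s * y s + (\<Sum>j\<in>?I. M i j * y j)"
      using s(2) by (simp add: distrib_left sum_distrib_left mult_ac)
    also have "\<dots> = 0"
      using null[OF that] fin s(1) by (simp add: sum.remove[of I s])
    finally show ?thesis using s(2) by simp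
  qed
  have vs: "(\<Sum>k<?n. u k * v s k) = - (\<Sum>j\<in>?I. y j / y s * (\<Sum>k<?n. u k * w j k))" for u
    unfolding v_def sum_distrib_left by (subst sum.swap) (simp add: sum_negf sum_distrib_left mult_ac)
  have vi: "(\<Sum>k<?n. v i k * v s k) = M i s" if "i \<in> ?I" for i
  proof -
    have "(\<Sum>j\<in>?I. y j / y s * (\<Sum>k<?n. v i k * w j k)) = (\<Sum>j\<in>?I. y j / y s * M i j)"
      using that w by (intro sum.cong) (auto simp: v_def)
    then show ?thesis unfolding vs using row[of i] that by simp
  qed
  have ss: "(\<Sum>k<?n. v s k * v s k) = M s s"
  proof -
    have "(\<Sum>k<?n. v s k * w j k) = M s j" if "j \<in> ?I" for j
      using vi[OF that] that sym[of j s] by (simp add: v_def mult.commute)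
    then have "(\<Sum>j\<in>?I. y j / y s * (\<Sum>k<?n. v s k * w j k)) = (\<Sum>j\<in>?I. y j / y s * M s j)"
      by (intro sum.cong) auto
    then show ?thesis unfolding vs[of "v s"] using row[OF s(1)] by simp
  qed
  have "(\<Sum>k<?n. v i k * v j k) = M i j" if ij: "i \<in> I" "j \<in> I" for i j
  proof -
    consider "i = s" "j = s" | "i \<in> ?I" "j = s" | "i = s" "j \<in> ?I" | "i \<in> ?I" "j \<in> ?I"
      using ij by blast
    then show ?thesis
    proof cases
      case 3
      then show ?thesis using vi[of j] sym[of s j] by (simp add: mult.commute)
    next
      case 4
      then show ?thesis using w by (auto simp: v_def)
    qed (use ss vi in auto)
  qed
  then show ?thesis by blast
qed

section \<open>The quadratic form of a graph\<close>

text \<open>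
  A finite simple graph with adjacency matrix A, together with a real parameter \<lambda> \<ge> 0. The object of
  study is the matrix \<lambda>I - A, whose bilinear form is \<open>bil\<close> and which maps a vector x to \<open>defect x\<close>: this
  is zero exactly when x solves the eigenvector equation for \<lambda>.
\<close>

locale shifted_graph =
  fixes V :: "'a set" and E :: "'a \<Rightarrow> 'a \<Rightarrow> bool" and lam :: real
  assumes finV: "finite V" and E_sym: "E u v \<Longrightarrow> E v u" and E_irrefl: "\<not> E u u"
    and lam_nonneg: "0 \<le> lam"
begin

definition nbr_sum :: "('a \<Rightarrow> real) \<Rightarrow> 'a \<Rightarrow> real" where
  "nbr_sum x u = (\<Sum>v\<in>V. of_bool (E u v) * x v)"

definition defect :: "('a \<Rightarrow> real) \<Rightarrow> 'a \<Rightarrow> real" where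
  "defect x u = lam * x u - nbr_sum x u"

definition bil :: "('a \<Rightarrow> real) \<Rightarrow> ('a \<Rightarrow> real) \<Rightarrow> real" where
  "bil x y = (\<Sum>u\<in>V. x u * defect y u)"

abbreviation form :: "('a \<Rightarrow> real) \<Rightarrow> real" where
  "form x \<equiv> bil x x"

definition supported :: "('a \<Rightarrow> real) \<Rightarrow> 'a set \<Rightarrow> bool" where
  "supported x X \<longleftrightarrow> (\<forall>u. u \<notin> X \<longrightarrow> x u = 0)"

lemma E_commute: "E u v \<longleftrightarrow> E v u"
  using E_sym by blast

lemma bil_commute: "bil x y = bil y x"
proof -
  have "(\<Sum>u\<in>V. x u * nbr_sum y u) = (\<Sum>u\<in>V. y u * nbr_sum x u)"
    unfolding nbr_sum_def sum_distrib_left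
    by (subst sum.swap) (auto intro!: sum.cong simp: E_commute)
  then show ?thesis
    unfolding bil_def defect_def by (simp add: right_diff_distrib sum_subtractf mult_ac)
qed

lemma nbr_sum_lin: "nbr_sum (\<lambda>u. a * x u + b * y u) v = a * nbr_sum x v + b * nbr_sum y v"
  unfolding nbr_sum_def by (simp add: sum_distrib_left sum.distrib distrib_left mult_ac)

lemma defect_lin: "defect (\<lambda>u. a * x u + b * y u) v = a * defect x v + b * defect y v"
  unfolding defect_def nbr_sum_lin by (simp add: algebra_simps)

lemma bil_lin_right: "bil z (\<lambda>u. a * x u + b * y u) = a * bil z x + b * bil z y"
  unfolding bil_def defect_lin by (simp add: sum_distrib_left sum.distrib distrib_left mult_ac)

lemma bil_lin_left: "bil (\<lambda>u. a * x u + b * y u) z = a * bil x z + b * bil y z"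
  using bil_lin_right[of z a x b y] by (simp add: bil_commute)

lemma form_lin:
  "form (\<lambda>u. a * x u + b * y u) = a\<^sup>2 * form x + 2 * a * b * bil x y + b\<^sup>2 * form y"
  unfolding bil_lin_right bil_lin_left bil_commute[of y x]
  by (simp add: power2_eq_square algebra_simps)

lemma form_scale: "form (\<lambda>u. c * x u) = c\<^sup>2 * form x"
  using form_lin[of c x 0 x] by simp

lemma form_expand:
  "form x = lam * (\<Sum>u\<in>V. (x u)\<^sup>2) - (\<Sum>u\<in>V. \<Sum>v\<in>V. of_bool (E u v) * x u * x v)"
  unfolding bil_def defect_def nbr_sum_def
  by (simp add: right_diff_distrib sum_subtractf sum_distrib_left power2_eq_square mult_ac)

lemma form_cong: "(\<And>u. u \<in> V \<Longrightarrow> x u = y u) \<Longrightarrow> form x = form y"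
  unfolding form_expand by simp

text \<open>
  The adjacency matrix has nonnegative entries. This inequality replaces the Perron-Frobenius
  theorem throughout.
\<close>

lemma form_abs_le: "form (\<lambda>u. \<bar>x u\<bar>) \<le> form x"
proof -
  have "(\<Sum>u\<in>V. \<Sum>v\<in>V. of_bool (E u v) * x u * x v)
      \<le> (\<Sum>u\<in>V. \<Sum>v\<in>V. of_bool (E u v) * \<bar>x u\<bar> * \<bar>x v\<bar>)"
    by (intro sum_mono) (auto simp: of_bool_def abs_le_iff simp flip: abs_mult)
  then show ?thesis
    unfolding form_expand by simp
qed

lemma bil_separated:
  assumes "\<And>u v. u \<in> V \<Longrightarrow> v \<in> V \<Longrightarrow> x u \<noteq> 0 \<Longrightarrow> y v \<noteq> 0 \<Longrightarrow> u \<noteq> v \<and> \<not> E u v"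
  shows "bil x y = 0"
  unfolding bil_def
proof (intro sum.neutral ballI)
  fix u assume u: "u \<in> V"
  show "x u * defect y u = 0"
  proof (cases "x u = 0")
    case False
    then have "y u = 0" and "\<And>v. v \<in> V \<Longrightarrow> E u v \<Longrightarrow> y v = 0"
      using assms[OF u] u by blast+
    then have "y u = 0" "nbr_sum y u = 0"
      unfolding nbr_sum_def by (auto intro!: sum.neutral simp: of_bool_def)
    then show ?thesis by (simp add: defect_def)
  qed simp
qed

lemma form_eq_0_if_defect:
  "(\<And>v. v \<in> V \<Longrightarrow> defect x v = 0) \<Longrightarrow> form x = 0"
  unfolding bil_def by simp

lemma bil_unit: "v \<in> V \<Longrightarrow> bil (\<lambda>u. of_bool (u = v)) y = defect y v"
  unfolding bil_def by (simp add: of_bool_def if_distrib[of "\<lambda>c. c * _"] sum.delta[OF finV] cong: if_cong)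

lemma form_unit: "v \<in> V \<Longrightarrow> form (\<lambda>u. of_bool (u = v)) = lam"
  using E_irrefl unfolding bil_unit defect_def nbr_sum_def
  by (auto intro!: sum.neutral simp: of_bool_def)

text \<open>
  A null vector minimises the form, so the form has derivative zero there in the direction of the
  unit vector at v.
\<close>

lemma null_vector_defect:
  assumes nonneg: "\<And>x. supported x X \<Longrightarrow> 0 \<le> form x"
    and "form y = 0" "supported y X" "v \<in> X" "v \<in> V"
  shows "defect y v = 0"
proof -
  let ?e = "\<lambda>u. of_bool (u = v) :: real"
  \<comment> \<open>the step -s in the direction of v decreases the form unless s = 0\<close>
  define s where "s = defect y v / (lam + 1)"
  have g: "defect y v = s * (lam + 1)"
    unfolding s_def using lam_nonneg by simp
  have "supported (\<lambda>u. 1 * y u + (- s) * ?e u) X"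
    using assms unfolding supported_def by (auto simp: of_bool_def)
  then have "0 \<le> form (\<lambda>u. 1 * y u + (- s) * ?e u)"
    by (rule nonneg)
  also have "\<dots> = - (2 * s * defect y v) + s\<^sup>2 * lam"
    unfolding form_lin using assms bil_unit[of v y] form_unit[of v] by (simp add: bil_commute)
  also have "\<dots> = - ((lam + 2) * s\<^sup>2)"
    unfolding g by (simp add: algebra_simps power2_eq_square)
  finally have "s\<^sup>2 \<le> 0"
    using lam_nonneg by (simp add: mult_le_0_iff)
  then show ?thesis using g by simp
qed

lemma supported_abs: "supported x X \<Longrightarrow> supported (\<lambda>u. \<bar>x u\<bar>) X"
  unfolding supported_def by simp

lemma null_vector_abs:
  assumes nonneg: "\<And>x. supported x X \<Longrightarrow> 0 \<le> form x" and "form y = 0" "supported y X"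
  shows "form (\<lambda>u. \<bar>y u\<bar>) = 0"
  using form_abs_le[of y] nonneg[OF supported_abs[OF assms(3)]] assms(2) by simp

text \<open>
  The absolute value of a null vector is again a null vector. At a zero v of it the eigenvector
  equation says that the sum of its nonnegative values at the neighbours of v is zero.
\<close>

lemma null_vector_zero_spreads:
  assumes nonneg: "\<And>x. supported x X \<Longrightarrow> 0 \<le> form x" and y: "form y = 0" "supported y X"
    and v: "v \<in> X" "v \<in> V" "y v = 0" and w: "w \<in> V" "E v w"
  shows "y w = 0"
proof -
  have "defect (\<lambda>u. \<bar>y u\<bar>) v = 0"
    by (rule null_vector_defect[OF nonneg null_vector_abs[OF nonneg y] supported_abs[OF y(2)] v(1,2)])
  then have "nbr_sum (\<lambda>u. \<bar>y u\<bar>) v = 0"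
    using v unfolding defect_def by simp
  then have "of_bool (E v w) * \<bar>y w\<bar> = 0"
    unfolding nbr_sum_def using w finV by (subst (asm) sum_nonneg_eq_0_iff) auto
  then show ?thesis using w by simp
qed

end

text \<open>
  Positivity of \<lambda>I - A + J/2, which up to a scalar is the Gram matrix of unit vectors on
  equiangular lines.
\<close>

locale equiangular_graph = shifted_graph +
  assumes gram_nonneg: "0 \<le> form x + (\<Sum>u\<in>V. x u)\<^sup>2 / 2"
begin

text \<open>
  Otherwise some combination of |b| and -|y| has entry sum zero, and on it the form would be
  negative, because the two vectors do not interact.
\<close>

lemma separated_from_negative:
  assumes b: "form b < 0" and y: "form y \<le> 0"
    and sep: "\<And>u v. u \<in> V \<Longrightarrow> v \<in> V \<Longrightarrow> b u \<noteq> 0 \<Longrightarrow> y v \<noteq> 0 \<Longrightarrow> u \<noteq> v \<and> \<not> E u v"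
    and u: "u \<in> V"
  shows "y u = 0"
proof (rule ccontr)
  assume "y u \<noteq> 0"
  define p q where "p = (\<Sum>u\<in>V. \<bar>b u\<bar>)" and "q = (\<Sum>u\<in>V. \<bar>y u\<bar>)"
  have "0 < q"
    unfolding q_def using finV u \<open>y u \<noteq> 0\<close> by (intro sum_pos2[of _ u]) auto
  define z where "z = (\<lambda>u. q * \<bar>b u\<bar> + (- p) * \<bar>y u\<bar>)"
  have "(\<Sum>u\<in>V. z u) = q * p - p * q"
    unfolding z_def p_def q_def by (simp add: sum_distrib_left sum_subtractf)
  then have "0 \<le> form z"
    using gram_nonneg[of z] by simp
  also have "form z = q\<^sup>2 * form (\<lambda>u. \<bar>b u\<bar>) + p\<^sup>2 * form (\<lambda>u. \<bar>y u\<bar>)"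
    unfolding z_def form_lin using sep by (subst bil_separated) auto
  also have "\<dots> < 0"
  proof -
    have "q\<^sup>2 * form (\<lambda>u. \<bar>b u\<bar>) < 0"
      using form_abs_le[of b] b \<open>0 < q\<close> by (intro mult_pos_neg) auto
    moreover have "p\<^sup>2 * form (\<lambda>u. \<bar>y u\<bar>) \<le> 0"
      using form_abs_le[of y] y by (intro mult_nonneg_nonpos) auto
    ultimately show ?thesis by linarith
  qed
  finally show False by simp
qed

end

section \<open>Cliques and degrees in graphs of equiangular lines\<close>

context shifted_graph
begin

definition nbrs :: "'a \<Rightarrow> 'a set" where
  "nbrs v = {u \<in> V. E v u}"

lemma finite_nbrs: "finite (nbrs v)"
  unfolding nbrs_def using finV by simp

lemma nbr_sum_eq: "nbr_sum x v = (\<Sum>u\<in>nbrs v. x u)"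
  unfolding nbr_sum_def nbrs_def of_bool_def using finV
  by (simp add: sum.inter_filter if_distrib[of "\<lambda>c. c * _"] cong: if_cong)

lemma sum_of_bool_mult: "(\<Sum>u\<in>V. of_bool (u \<in> A) * f u) = (\<Sum>u\<in>V \<inter> A. f u :: real)"
  using finV unfolding of_bool_def
  by (simp add: sum.inter_restrict if_distrib[of "\<lambda>c. c * _"] cong: if_cong)

lemma sum_indicator: "A \<subseteq> V \<Longrightarrow> (\<Sum>u\<in>V. of_bool (u \<in> A)) = (real (card A))"
  using sum_of_bool_mult[of A "\<lambda>_. 1"] by (simp add: Int_absorb1)

lemma nbr_sum_indicator: "nbr_sum (\<lambda>u. of_bool (u \<in> A)) v = real (card (nbrs v \<inter> A))"
  unfolding nbr_sum_eq using finite_nbrs by (simp add: sum.If_cases of_bool_def Int_def)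

lemma bil_indicator:
  assumes "A \<subseteq> V"
  shows "bil (\<lambda>u. of_bool (u \<in> A)) (\<lambda>u. of_bool (u \<in> B))
    = lam * real (card (A \<inter> B)) - (\<Sum>u\<in>A. real (card (nbrs u \<inter> B)))"
proof -
  have "bil (\<lambda>u. of_bool (u \<in> A)) (\<lambda>u. of_bool (u \<in> B))
      = (\<Sum>u\<in>A. lam * of_bool (u \<in> B) - real (card (nbrs u \<inter> B)))"
    unfolding bil_def sum_of_bool_mult defect_def nbr_sum_indicator using assms
    by (simp add: Int_absorb1)
  also have "(\<Sum>u\<in>A. lam * of_bool (u \<in> B)) = lam * real (card (A \<inter> B))"
    using finite_subset[OF assms finV]
    by (simp add: sum.If_cases of_bool_def Int_def flip: sum_distrib_left)
  ultimately show ?thesis by (simp add: sum_subtractf)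
qed

end

context equiangular_graph
begin

text \<open>
  On the indicator of a clique of size k the form with the J/2 term equals
  k (\<lambda> + 1 - k/2).
\<close>

lemma clique_card_le:
  assumes "K \<subseteq> V" and clique: "\<And>u v. u \<in> K \<Longrightarrow> v \<in> K \<Longrightarrow> u \<noteq> v \<Longrightarrow> E u v"
  shows "real (card K) \<le> 2 * (lam + 1)"
proof (cases "K = {}")
  case False
  let ?x = "\<lambda>u. of_bool (u \<in> K) :: real" and ?k = "real (card K)"
  have fin: "finite K" using assms(1) finV finite_subset by blast
  have "nbrs u \<inter> K = K - {u}" if "u \<in> K" for u
    using that clique assms(1) E_irrefl unfolding nbrs_def by auto
  then have "(\<Sum>u\<in>K. real (card (nbrs u \<inter> K))) = ?k * (?k - 1)"
    using fin False by (simp add: of_nat_diff card_gt_0_iff Suc_le_eq)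
  then have "0 \<le> lam * ?k - ?k * (?k - 1) + ?k\<^sup>2 / 2"
    using gram_nonneg[of ?x] bil_indicator[OF assms(1), of K] sum_indicator[OF assms(1)] by simp
  then have "0 \<le> ?k * (2 * (lam + 1) - ?k)"
    by (simp add: power2_eq_square algebra_simps)
  moreover have "0 < ?k"
    using fin False by (simp add: card_gt_0_iff)
  ultimately show ?thesis
    by (simp add: zero_le_mult_iff)
qed (use lam_nonneg in simp)

text \<open>
  If v were joined to the set B and to no vertex of the set P, both of 25 vertices in S, then the
  vector that is -7 at v, 1 on P and -1 on B would violate positivity: the edges from v to B
  contribute -350, and all other terms together at most 3 * 99 + 49/2.
\<close>

lemma not_both_large:
  assumes lam: "lam \<le> 3"
    and S: "S \<subseteq> V" "\<And>u w. u \<in> S \<Longrightarrow> w \<in> S \<Longrightarrow> \<not> E u w"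
    and v: "v \<in> V" "v \<notin> S" and card: "25 \<le> card (S \<inter> nbrs v)"
  shows "card (S - nbrs v) < 25"
proof (rule ccontr)
  assume "\<not> card (S - nbrs v) < 25"
  then have "25 \<le> card (S - nbrs v)" by simp
  then obtain P where P: "P \<subseteq> S - nbrs v" "card P = 25"
    by (rule obtain_subset_with_card_n)
  obtain B where B: "B \<subseteq> S \<inter> nbrs v" "card B = 25"
    using card by (rule obtain_subset_with_card_n)
  let ?p = "\<lambda>u. of_bool (u \<in> P) :: real" and ?b = "\<lambda>u. of_bool (u \<in> B) :: real"
    and ?e = "\<lambda>u. of_bool (u \<in> {v}) :: real"
  define y where "y = (\<lambda>u. 1 * ?p u + (- 1) * ?b u)"
  have sub: "P \<subseteq> V" "B \<subseteq> V" "{v} \<subseteq> V" using P B S v by auto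
  have no: "nbrs u \<inter> P = {}" "nbrs u \<inter> B = {}" if "u \<in> S" for u
    using S(2)[OF that] P(1) B(1) unfolding nbrs_def by auto
  have zero: "(\<Sum>u\<in>P. real (card (nbrs u \<inter> P))) = 0" "(\<Sum>u\<in>P. real (card (nbrs u \<inter> B))) = 0"
    "(\<Sum>u\<in>B. real (card (nbrs u \<inter> B))) = 0"
    using no P(1) B(1) by (auto intro!: sum.neutral)
  have disj: "P \<inter> B = {}" "{v} \<inter> P = {}" "{v} \<inter> B = {}" "nbrs v \<inter> P = {}" "nbrs v \<inter> B = B"
    "nbrs v \<inter> {v} = {}"
    using P B v E_irrefl unfolding nbrs_def by auto
  have yy: "form y = 50 * lam"
    unfolding y_def form_lin bil_indicator[OF sub(1)] bil_indicator[OF sub(2)]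
    using zero disj P(2) B(2) by simp
  have ey: "bil ?e y = 25"
    unfolding y_def bil_lin_right bil_indicator[OF sub(3)] using disj B(2) by simp
  have ee: "form ?e = lam"
    unfolding bil_indicator[OF sub(3)] using disj by simp
  have "form (\<lambda>u. (- 7) * ?e u + 1 * y u) = 49 * lam - 350 + 50 * lam"
    unfolding form_lin yy ey ee by simp
  moreover have "(\<Sum>u\<in>V. (- 7) * ?e u + 1 * y u) = - 7"
    unfolding y_def using sum_indicator[OF sub(1)] sum_indicator[OF sub(2)] sum_indicator[OF sub(3)] P(2) B(2)
    by (simp add: sum.distrib sum_subtractf flip: sum_distrib_left)
  ultimately show False
    using gram_nonneg[of "\<lambda>u. (- 7) * ?e u + 1 * y u"] lam by simp
qed

text \<open>
  A star with 25 leaves has spectral radius 5 > 3, so the form is very negative on a vector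
  that is 4 at v and 1 on 25 neighbours. Its entry sum 29 is cancelled by spreading -29 evenly over S.
  That costs little, because S is large, independent and joined to the star by few edges.
\<close>

lemma degree_less_25:
  assumes lam: "lam \<le> 3"
    and S: "S \<subseteq> V" "\<And>u w. u \<in> S \<Longrightarrow> w \<in> S \<Longrightarrow> \<not> E u w" "626 \<le> card S"
    and few: "\<And>v. v \<in> V \<Longrightarrow> card (S \<inter> nbrs v) < 25"
    and v: "v \<in> V"
  shows "card (nbrs v) < 25"
proof (rule ccontr)
  assume "\<not> card (nbrs v) < 25"
  then have "25 \<le> card (nbrs v)" by simp
  then obtain T where T: "T \<subseteq> nbrs v" "card T = 25"
    by (rule obtain_subset_with_card_n)
  define R where "R = S - ({v} \<union> T)"
  have finS: "finite S" using S(1) finV finite_subset by blast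
  have finT: "finite T" using T(1) finite_nbrs finite_subset by blast
  have "card S - card ({v} \<union> T) \<le> card R"
    unfolding R_def using finT by (intro diff_card_le_card_Diff) auto
  moreover have "card ({v} \<union> T) \<le> 26"
    using card_Un_le[of "{v}" T] T(2) by simp
  ultimately have R600: "600 \<le> real (card R)" using S(3) by simp
  \<comment> \<open>29 = 4 + 25 is the sum of the values 4 at v and 1 on T\<close>
  define c where "c = 29 / real (card R)"
  have c: "0 < c" "c * real (card R) = 29" "c * 6000 \<le> 290"
    using R600 unfolding c_def by (auto simp: field_simps)
  let ?e = "\<lambda>u. of_bool (u \<in> {v}) :: real" and ?t = "\<lambda>u. of_bool (u \<in> T) :: real"
    and ?r = "\<lambda>u. of_bool (u \<in> R) :: real"
  have sub: "{v} \<subseteq> V" "T \<subseteq> V" "R \<subseteq> V"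
    using v T(1) S(1) unfolding nbrs_def R_def by auto
  have disj: "{v} \<inter> T = {}" "{v} \<inter> R = {}" "T \<inter> R = {}" "nbrs v \<inter> T = T" "nbrs v \<inter> {v} = {}"
    using T(1) E_irrefl unfolding nbrs_def R_def by auto
  have few': "real (card (nbrs u \<inter> R)) \<le> 24" if "u \<in> V" for u
  proof -
    have "card (nbrs u \<inter> R) \<le> card (S \<inter> nbrs u)"
      unfolding R_def using finS by (intro card_mono) auto
    then show ?thesis using few[OF that] by simp
  qed
  have ee: "form ?e = lam"
    unfolding bil_indicator[OF sub(1)] using disj by simp
  have et: "bil ?e ?t = - 25"
    unfolding bil_indicator[OF sub(1)] using disj T(2) by simp
  have er: "- 24 \<le> bil ?e ?r"
    unfolding bil_indicator[OF sub(1)] using disj few'[OF v] by simp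
  have tt: "form ?t \<le> 25 * lam"
    unfolding bil_indicator[OF sub(2)] using T(2) by (simp add: sum_nonneg)
  have "(\<Sum>u\<in>T. real (card (nbrs u \<inter> R))) \<le> (\<Sum>u\<in>T. 24)"
    using few' sub(2) by (intro sum_mono) auto
  then have tr: "- 600 \<le> bil ?t ?r"
    unfolding bil_indicator[OF sub(2)] using disj T(2) by simp
  have "nbrs u \<inter> R = {}" if "u \<in> R" for u
    using S(2) that unfolding R_def nbrs_def by auto
  then have "(\<Sum>u\<in>R. real (card (nbrs u \<inter> R))) = 0"
    by (auto intro!: sum.neutral)
  then have rr: "form ?r = lam * real (card R)"
    unfolding bil_indicator[OF sub(3)] by simp
  define y where "y = (\<lambda>u. 4 * ?e u + 1 * ?t u)"
  have yy: "form y \<le> 16 * lam - 200 + 25 * lam"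
    unfolding y_def form_lin ee et using tt by simp
  have yr: "- 696 \<le> bil y ?r"
    unfolding y_def bil_lin_left using er tr by simp
  let ?x = "\<lambda>u. 1 * y u + (- c) * ?r u"
  have "form ?x = form y - 2 * c * bil y ?r + c\<^sup>2 * form ?r"
    unfolding form_lin by simp
  also have "c\<^sup>2 * form ?r = c * lam * 29"
    unfolding rr c(2)[symmetric] by (simp add: power2_eq_square)
  also have "form y - 2 * c * bil y ?r + c * lam * 29 < 0"
  proof -
    have "c * (- 696) \<le> c * bil y ?r"
      using yr c(1) by (intro mult_left_mono) auto
    moreover have "c * lam \<le> c * 3"
      using lam c(1) by (intro mult_left_mono) auto
    ultimately show ?thesis using yy c(3) lam by linarith
  qed
  finally have "form ?x < 0" .
  moreover have "(\<Sum>u\<in>V. ?x u) = 0"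
  proof -
    have "(\<Sum>u\<in>V. ?x u) = 4 * real (card {v}) + real (card T) - c * real (card R)"
      unfolding y_def using sum_indicator[OF sub(1)] sum_indicator[OF sub(2)] sum_indicator[OF sub(3)]
      by (simp add: sum.distrib sum_subtractf flip: sum_distrib_left)
    then show ?thesis using T(2) c(2) by simp
  qed
  ultimately show False
    using gram_nonneg[of ?x] by simp
qed

end

section \<open>Components and breadth-first balls\<close>

context shifted_graph
begin

definition arc_rel :: "('a \<times> 'a) set" where
  "arc_rel = {(u, v). u \<in> V \<and> v \<in> V \<and> E u v}"

definition component :: "'a \<Rightarrow> 'a set" where
  "component r = arc_rel\<^sup>* `` {r}"

primrec bfs_ball :: "'a \<Rightarrow> nat \<Rightarrow> 'a set" where
  "bfs_ball r 0 = {r}"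
| "bfs_ball r (Suc k) = bfs_ball r k \<union> (\<Union>v\<in>bfs_ball r k. nbrs v)"

lemma component_refl: "r \<in> component r"
  unfolding component_def by simp

lemma component_subset: "r \<in> V \<Longrightarrow> component r \<subseteq> V"
  unfolding component_def arc_rel_def by (auto elim: rtranclE)

lemma component_step: "u \<in> component r \<Longrightarrow> u \<in> V \<Longrightarrow> v \<in> V \<Longrightarrow> E u v \<Longrightarrow> v \<in> component r"
  unfolding component_def arc_rel_def by (auto intro: rtrancl_into_rtrancl)

lemma component_eq: "u \<in> component r \<Longrightarrow> component u = component r"
proof -
  assume "u \<in> component r"
  have "sym arc_rel" unfolding arc_rel_def using E_sym by (auto intro: symI)
  then have "sym (arc_rel\<^sup>*)" by (rule sym_rtrancl)
  then have "(u, r) \<in> arc_rel\<^sup>*" "(r, u) \<in> arc_rel\<^sup>*"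
    using \<open>u \<in> component r\<close> unfolding component_def by (auto dest: symD)
  then show ?thesis unfolding component_def by (auto intro: rtrancl_trans)
qed

lemma bfs_ball_mono: "j \<le> k \<Longrightarrow> bfs_ball r j \<subseteq> bfs_ball r k"
  by (induction k) (auto simp: le_Suc_eq)

lemma bfs_ball_Suc: "bfs_ball r k \<subseteq> bfs_ball r (Suc k)"
  by auto

lemma bfs_ball_subset: "r \<in> V \<Longrightarrow> bfs_ball r k \<subseteq> V"
  by (induction k) (auto simp: nbrs_def)

lemma bfs_ball_step: "u \<in> bfs_ball r k \<Longrightarrow> v \<in> V \<Longrightarrow> E u v \<Longrightarrow> v \<in> bfs_ball r (Suc k)"
  by (auto simp: nbrs_def)

lemma component_iff_bfs_ball: "r \<in> V \<Longrightarrow> u \<in> component r \<longleftrightarrow> (\<exists>k. u \<in> bfs_ball r k)"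
proof
  assume r: "r \<in> V"
  show "\<exists>k. u \<in> bfs_ball r k" if "u \<in> component r"
  proof -
    from that have "(r, u) \<in> arc_rel\<^sup>*" unfolding component_def by simp
    then show ?thesis
    proof (induction rule: rtrancl_induct)
      case base
      have "r \<in> bfs_ball r 0" by simp
      then show ?case by blast
    next
      case (step y z)
      then obtain k where "y \<in> bfs_ball r k" by blast
      with step have "z \<in> bfs_ball r (Suc k)"
        using bfs_ball_step unfolding arc_rel_def by blast
      then show ?case by blast
    qed
  qed
  show "u \<in> component r" if "\<exists>k. u \<in> bfs_ball r k"
  proof -
    have "bfs_ball r k \<subseteq> component r" for k
    proof (induction k)
      case (Suc k)
      have "v \<in> component r" if "u \<in> bfs_ball r k" "v \<in> nbrs u" for u v
        using component_step[of u r v] Suc bfs_ball_subset[OF r, of k] that unfolding nbrs_def by blast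
      then show ?case using Suc by auto
    qed (use component_refl in auto)
    then show ?thesis using that by blast
  qed
qed

end

section \<open>Spiders\<close>

context shifted_graph
begin

text \<open>
  Three paths of n edges that start at the common vertex \<open>a 0 0\<close> and are disjoint otherwise; \<open>a i t\<close> is
  the vertex at distance t on the path i.
\<close>

definition spider :: "nat \<Rightarrow> (nat \<Rightarrow> nat \<Rightarrow> 'a) \<Rightarrow> bool" where
  "spider n a \<longleftrightarrow> (\<forall>i<3. \<forall>t\<le>n. a i t \<in> V) \<and> (\<forall>i<3. \<forall>t<n. E (a i t) (a i (Suc t)))
     \<and> (\<forall>i<3. a i 0 = a 0 0)
     \<and> (\<forall>i<3. \<forall>j<3. \<forall>s\<le>n. \<forall>t\<le>n. a i s = a j t \<longrightarrow> s = t \<and> (s = 0 \<or> i = j))"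

definition spider_set :: "nat \<Rightarrow> (nat \<Rightarrow> nat \<Rightarrow> 'a) \<Rightarrow> 'a set" where
  "spider_set n a = (\<lambda>(i, t). a i t) ` ({..<3} \<times> {..n})"

lemma card_spider_set: "card (spider_set n a) \<le> 3 * (n + 1)"
  unfolding spider_set_def
  by (rule order_trans[OF card_image_le]) (auto simp: card_cartesian_product)

lemma sum_le_nbr_sum:
  assumes "W \<subseteq> nbrs u" "\<And>v. 0 \<le> b v"
  shows "sum b W \<le> nbr_sum b u"
  unfolding nbr_sum_eq using assms finite_nbrs by (intro sum_mono2) auto

text \<open>
  On three infinite rays joined at a vertex, the function (1/\<surd>2)^t of the distance t from that vertex is
  an eigenfunction with eigenvalue 3/\<surd>2. Truncating the rays at distance n disturbs the equation at the
  three endpoints only, by an amount of order 2^(-n).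
\<close>

lemma spider_negative:
  assumes sp: "spider n a" and lam: "lam \<le> l0" and n: "3 * (1 / sqrt 2) * (1 / 2) ^ n < 3 / sqrt 2 - l0"
  shows "\<exists>b. supported b (spider_set n a) \<and> form b < 0"
proof -
  define s where "s = 1 / sqrt 2"
  have s: "0 < s" "s * s = 1 / 2" unfolding s_def by auto
  have ss: "s * (s * x) = x / 2" for x using s(2) by (simp flip: mult.assoc)
  have n': "3 * s * (1 / 2) ^ n < 3 * s - l0"
    using n unfolding s_def by simp
  have "n \<noteq> 0"
    using n' lam lam_nonneg by (intro notI) simp
  have aV: "a i t \<in> V" if "i < 3" "t \<le> n" for i t using sp that unfolding spider_def by blast
  have aE: "E (a i t) (a i (Suc t))" if "i < 3" "t < n" for i t using sp that unfolding spider_def by blast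
  have a0: "a i 0 = a 0 0" if "i < 3" for i using sp that unfolding spider_def by blast
  have inj: "t' = t \<and> (t' = 0 \<or> i = j)" if "a i t' = a j t" "i < 3" "j < 3" "t' \<le> n" "t \<le> n" for i j t' t
    using sp that unfolding spider_def by blast
  define B where "B = spider_set n a"
  have BI: "a i t \<in> B" if "i < 3" "t \<le> n" for i t
    unfolding B_def spider_set_def using that by (intro image_eqI[of _ _ "(i, t)"]) auto
  have BE: "\<exists>i t. i < 3 \<and> t \<le> n \<and> u = a i t" if "u \<in> B" for u
    using that unfolding B_def spider_set_def by auto
  have BV: "B \<subseteq> V" using BE aV by blast
  have finB: "finite B" unfolding B_def spider_set_def by simp
  \<comment> \<open>the distance of a vertex of the spider from its centre\<close>
  define ht where "ht u = (SOME t. \<exists>i<3. t \<le> n \<and> u = a i t)" for u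
  have ht: "ht (a i t) = t" if "i < 3" "t \<le> n" for i t
  proof -
    have "\<exists>i'<3. ht (a i t) \<le> n \<and> a i t = a i' (ht (a i t))"
      unfolding ht_def by (rule someI_ex) (use that in blast)
    then obtain i' where "i' < 3" "ht (a i t) \<le> n" "a i t = a i' (ht (a i t))" by blast
    then have "t = ht (a i t)" using inj[of i t i' "ht (a i t)"] that by simp
    then show ?thesis by simp
  qed
  define b where "b u = (if u \<in> B then s ^ ht u else 0)" for u
  have b: "b (a i t) = s ^ t" if "i < 3" "t \<le> n" for i t
    unfolding b_def using BI[OF that] ht[OF that] by simp
  have b_nonneg: "0 \<le> b u" for u unfolding b_def using s by simp
  define T where "T = (\<lambda>i. a i n) ` {..<3}"
  have TB: "T \<subseteq> B" unfolding T_def using BI by auto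
  have nb: "a i t \<in> nbrs (a i (Suc t))" "a i (Suc t) \<in> nbrs (a i t)" if "i < 3" "t < n" for i t
    using aE[OF that] aV[OF that(1)] that E_sym unfolding nbrs_def by auto
  \<comment> \<open>inside the legs the eigenvector equation for 3s = 3/\<surd>2 holds; at the ends one neighbour is missing\<close>
  have key: "b u * defect b u \<le> (lam - 3 * s) * (b u)\<^sup>2 + of_bool (u \<in> T) * (s * (1 / 2) ^ n)"
    if "u \<in> B" for u
  proof -
    obtain i t where i: "i < 3" "t \<le> n" "u = a i t" using BE[OF \<open>u \<in> B\<close>] by blast
    have bu: "b u = s ^ t" using b i by simp
    have "b u * (3 * s * b u - nbr_sum b u) \<le> of_bool (u \<in> T) * (s * (1 / 2) ^ n)"
    proof -
      consider "t = 0" | t' where "t = Suc t'" "t < n" | "t = n" "t \<noteq> 0"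
        using i by (cases t) (auto simp: le_less)
      then show ?thesis
      proof cases
        case 1
        have W: "{a 0 1, a 1 1, a 2 1} \<subseteq> nbrs u"
          using nb(2)[of 0 0] nb(2)[of 1 0] nb(2)[of 2 0] a0[of 1] a0[of 2] a0[of i] i 1 \<open>n \<noteq> 0\<close> by auto
        have "a 0 1 \<noteq> a 1 1" "a 0 1 \<noteq> a 2 1" "a 1 1 \<noteq> a 2 1"
          using inj[of 0 1 1 1] inj[of 0 1 2 1] inj[of 1 1 2 1] \<open>n \<noteq> 0\<close> by auto
        then have "sum b {a 0 1, a 1 1, a 2 1} = 3 * s"
          using b[of 0 1] b[of 1 1] b[of 2 1] \<open>n \<noteq> 0\<close> by simp
        then have "3 * s \<le> nbr_sum b u"
          using sum_le_nbr_sum[of _ u b, OF W b_nonneg] by simp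
        then have "b u * (3 * s * b u - nbr_sum b u) \<le> 0"
          using bu 1 by simp
        then show ?thesis using s by (simp add: order_trans)
      next
        case 2
        have W: "{a i t', a i (Suc t)} \<subseteq> nbrs u"
          using nb[of i t'] nb[of i t] i 2 by auto
        have "a i t' \<noteq> a i (Suc t)"
          using inj[of i t' i "Suc t"] i 2 by auto
        then have "sum b {a i t', a i (Suc t)} = 3 * s * b u"
          using b[of i t'] b[of i "Suc t"] i 2 unfolding bu by (simp add: ss mult.assoc)
        then have "3 * s * b u \<le> nbr_sum b u"
          using sum_le_nbr_sum[of _ u b, OF W b_nonneg] by simp
        then have "b u * (3 * s * b u - nbr_sum b u) \<le> 0"
          using b_nonneg by (intro mult_nonneg_nonpos) auto
        then show ?thesis using s by (simp add: order_trans)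
      next
        case 3
        then obtain t' where t': "t = Suc t'" by (cases t) auto
        have W: "{a i t'} \<subseteq> nbrs u"
          using nb[of i t'] i 3 t' by auto
        have "sum b {a i t'} = 2 * s * b u"
          using b[of i t'] i t' 3(1)[symmetric] unfolding bu by (simp add: ss mult.assoc)
        then have "2 * s * b u \<le> nbr_sum b u"
          using sum_le_nbr_sum[of _ u b, OF W b_nonneg] by simp
        then have "b u * (3 * s * b u - nbr_sum b u) \<le> b u * (s * b u)"
          using b_nonneg by (intro mult_left_mono) auto
        also have "\<dots> = s * (1 / 2) ^ n"
          unfolding bu 3(1) s(2)[symmetric] power_mult_distrib by simp
        finally show ?thesis using i 3 unfolding T_def by simp
      qed
    qed
    then show ?thesis
      unfolding defect_def by (simp add: power2_eq_square algebra_simps)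
  qed
  have "form b = (\<Sum>u\<in>B. b u * defect b u)"
    unfolding bil_def using BV finV by (intro sum.mono_neutral_right) (auto simp: b_def)
  also have "\<dots> \<le> (\<Sum>u\<in>B. (lam - 3 * s) * (b u)\<^sup>2 + of_bool (u \<in> T) * (s * (1 / 2) ^ n))"
    by (intro sum_mono key)
  also have "\<dots> = (lam - 3 * s) * (\<Sum>u\<in>B. (b u)\<^sup>2) + (\<Sum>u\<in>B. of_bool (u \<in> T)) * (s * (1 / 2) ^ n)"
    by (simp add: sum.distrib sum_distrib_left sum_distrib_right)
  also have "\<dots> < 0"
  proof -
    have "(b (a 0 0))\<^sup>2 \<le> (\<Sum>u\<in>B. (b u)\<^sup>2)"
      using finB BI[of 0 0] by (intro member_le_sum) auto
    then have 1: "1 \<le> (\<Sum>u\<in>B. (b u)\<^sup>2)" using b[of 0 0] by simp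
    have neg: "lam - 3 * s < 0"
    proof -
      have "0 \<le> 3 * s * (1 / 2) ^ n" using s by simp
      then show ?thesis using n' lam by linarith
    qed
    have 2: "(lam - 3 * s) * (\<Sum>u\<in>B. (b u)\<^sup>2) \<le> (lam - 3 * s) * 1"
      using neg 1 by (intro mult_left_mono_neg) auto
    have "(\<Sum>u\<in>B. of_bool (u \<in> T)) = real (card T)"
      using finB TB by (simp add: of_bool_def sum.If_cases Int_absorb1)
    also have "\<dots> \<le> 3"
      unfolding T_def using card_image_le[of "{..<3::nat}" "\<lambda>i. a i n"] by simp
    finally have "(\<Sum>u\<in>B. of_bool (u \<in> T)) * (s * (1 / 2) ^ n) \<le> 3 * (s * (1 / 2) ^ n)"
      using s by (intro mult_right_mono) auto
    then show ?thesis using 2 n' lam by simp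
  qed
  finally have "form b < 0" .
  moreover have "supported b (spider_set n a)"
    unfolding supported_def b_def B_def by simp
  ultimately show ?thesis by blast
qed

end

section \<open>Breadth-first layers\<close>

context shifted_graph
begin

definition lev :: "'a \<Rightarrow> 'a \<Rightarrow> nat" where
  "lev r u = (LEAST k. u \<in> bfs_ball r k)"

definition layer :: "'a \<Rightarrow> nat \<Rightarrow> 'a set" where
  "layer r k = {u \<in> component r. lev r u = k}"

definition parent :: "'a \<Rightarrow> 'a \<Rightarrow> 'a" where
  "parent r u = (if lev r u = 0 then u
     else SOME p. p \<in> component r \<and> E p u \<and> Suc (lev r p) = lev r u)"

lemma lev_le: "u \<in> bfs_ball r k \<Longrightarrow> lev r u \<le> k"
  unfolding lev_def by (rule Least_le)

lemma in_bfs_ball_lev: "r \<in> V \<Longrightarrow> u \<in> component r \<Longrightarrow> u \<in> bfs_ball r (lev r u)"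
  unfolding lev_def component_iff_bfs_ball by (rule LeastI_ex)

lemma bfs_ball_iff_lev: "r \<in> V \<Longrightarrow> u \<in> bfs_ball r k \<longleftrightarrow> u \<in> component r \<and> lev r u \<le> k"
  using lev_le in_bfs_ball_lev bfs_ball_mono component_iff_bfs_ball by blast

lemma lev_eq_0: "r \<in> V \<Longrightarrow> u \<in> component r \<Longrightarrow> lev r u = 0 \<longleftrightarrow> u = r"
  using bfs_ball_iff_lev[of r u 0] by auto

lemma parent:
  assumes r: "r \<in> V" and u: "u \<in> component r" "0 < lev r u"
  shows "parent r u \<in> component r" "E (parent r u) u" "Suc (lev r (parent r u)) = lev r u"
proof -
  obtain k where k: "lev r u = Suc k" using u(2) by (cases "lev r u") auto
  then have "u \<in> bfs_ball r (Suc k)" "u \<notin> bfs_ball r k"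
    using u bfs_ball_iff_lev[OF r, of u "Suc k"] bfs_ball_iff_lev[OF r, of u k]
    by (simp_all del: bfs_ball.simps)
  then obtain p where p: "p \<in> bfs_ball r k" "E p u"
    by (auto simp: nbrs_def)
  then have "p \<in> component r" "lev r p \<le> k"
    using bfs_ball_iff_lev[OF r] by auto
  moreover have "u \<in> V" using component_subset[OF r] u by auto
  then have "u \<in> bfs_ball r (Suc (lev r p))"
    using in_bfs_ball_lev[OF r \<open>p \<in> component r\<close>] p(2) bfs_ball_step by blast
  then have "Suc k \<le> Suc (lev r p)"
    using lev_le k by metis
  ultimately have "\<exists>p. p \<in> component r \<and> E p u \<and> Suc (lev r p) = lev r u"
    using p(2) k by auto
  from someI_ex[OF this] show "parent r u \<in> component r" "E (parent r u) u"
    "Suc (lev r (parent r u)) = lev r u"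
    using u(2) unfolding parent_def by auto
qed

lemma parent_fix: "lev r u = 0 \<Longrightarrow> parent r u = u"
  unfolding parent_def by simp

lemma parent_component: "r \<in> V \<Longrightarrow> u \<in> component r \<Longrightarrow> parent r u \<in> component r"
  using parent(1) by (cases "lev r u = 0") (auto simp: parent_def)

text \<open>
  The root is its own parent, so iterated parents are defined for every number of steps.
\<close>

abbreviation anc :: "'a \<Rightarrow> nat \<Rightarrow> 'a \<Rightarrow> 'a" where
  "anc r m u \<equiv> (parent r ^^ m) u"

lemma anc_component: "r \<in> V \<Longrightarrow> u \<in> component r \<Longrightarrow> anc r m u \<in> component r"
  by (induction m) (auto intro: parent_component)

lemma lev_anc: "r \<in> V \<Longrightarrow> u \<in> component r \<Longrightarrow> lev r (anc r m u) = lev r u - m"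
proof (induction m)
  case (Suc m)
  then show ?case
    using parent(3)[OF Suc.prems(1) anc_component[OF Suc.prems, of m]] parent_fix[of r "anc r m u"]
    by (cases "lev r (anc r m u) = 0") auto
qed simp

lemma anc_edge:
  assumes "r \<in> V" "u \<in> component r" "m < lev r u"
  shows "E (anc r (Suc m) u) (anc r m u)"
  using parent(2)[OF assms(1) anc_component[OF assms(1,2), of m]] lev_anc[OF assms(1,2), of m] assms(3)
  by simp

lemma anc_root: "r \<in> V \<Longrightarrow> u \<in> component r \<Longrightarrow> lev r u \<le> m \<Longrightarrow> anc r m u = r"
  using lev_eq_0[of r "anc r m u"] anc_component[of r u m] lev_anc[of r u m] by simp

lemma anc_add: "anc r (m + n) u = anc r m (anc r n u)"
  by (simp add: funpow_add)

text \<open>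
  The body of the spider is the common ancestor x of u1 and u2, and the first two legs descend from x
  towards u1 and u2. The third leg climbs from x until it meets the ancestral path of u3 and then
  descends towards u3. Levels tell the vertices of one leg apart. Vertices of equal level on different legs are
  distinct because the three paths are disjoint before generation J and I is least.
\<close>

lemma spider_of_merge:
  assumes r: "r \<in> V" and u: "u1 \<in> layer r k" "u2 \<in> layer r k" "u3 \<in> layer r k"
    and J: "n < J" "J \<le> k" "anc r J u1 = anc r J u2"
    and distinct: "\<And>m. m < J \<Longrightarrow> anc r m u1 \<noteq> anc r m u2 \<and> anc r m u1 \<noteq> anc r m u3 \<and> anc r m u2 \<noteq> anc r m u3"
  shows "\<exists>a. spider n a"
proof -
  have uc: "u1 \<in> component r" "u2 \<in> component r" "u3 \<in> component r" "lev r u1 = k" "lev r u2 = k" "lev r u3 = k"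
    using u unfolding layer_def by auto
  \<comment> \<open>the number of steps that the third leg climbs from the body\<close>
  define I where "I = (LEAST i. anc r (J + i) u1 = anc r (J + i) u3)"
  have ex: "anc r (J + (k - J)) u1 = anc r (J + (k - J)) u3"
    using anc_root[OF r uc(1)] anc_root[OF r uc(3)] uc J by simp
  have I: "anc r (J + I) u1 = anc r (J + I) u3"
    unfolding I_def by (rule LeastI, rule ex)
  have I_le: "I \<le> i" if "anc r (J + i) u1 = anc r (J + i) u3" for i
    unfolding I_def using that by (rule Least_le)
  have IkJ: "I \<le> k - J" by (rule I_le, rule ex)
  define a2 where "a2 t = (if t \<le> I then anc r (J + t) u1 else anc r (J + 2 * I - t) u3)" for t
  define a where "a i t = (if i = 0 then anc r (J - t) u1 else if i = 1 then anc r (J - t) u2 else a2 t)"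
    for i t :: nat
  have lev01: "lev r (anc r (J - t) u1) = k - J + t" "lev r (anc r (J - t) u2) = k - J + t"
    if "t \<le> n" for t
    using lev_anc[OF r uc(1)] lev_anc[OF r uc(2)] uc J that by auto
  have lev2: "lev r (a2 t) = (if t \<le> I then k - J - t else k - J + t - 2 * I)" if "t \<le> n" for t
    using lev_anc[OF r uc(1)] lev_anc[OF r uc(3)] uc J IkJ that unfolding a2_def by auto
  have i3: "i = 0 \<or> i = 1 \<or> i = 2" if "i < 3" for i :: nat using that by auto
  have V: "a i t \<in> V" for i t
    using anc_component[OF r] uc component_subset[OF r] unfolding a_def a2_def by auto
  have root: "a i 0 = a 0 0" if "i < 3" for i
    using J(3) unfolding a_def a2_def by auto
  have edge: "E (a i t) (a i (Suc t))" if "i < 3" "t < n" for i t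
  proof -
    have S: "J - t = Suc (J - Suc t)" using that J by simp
    have "E (anc r (J - t) u1) (anc r (J - Suc t) u1)" "E (anc r (J - t) u2) (anc r (J - Suc t) u2)"
      unfolding S using that J uc by (auto intro!: anc_edge[OF r] simp del: funpow.simps)
    moreover have "E (a2 t) (a2 (Suc t))"
    proof (cases "Suc t \<le> I")
      case True
      have "E (anc r (Suc (J + t)) u1) (anc r (J + t) u1)"
        using True IkJ J uc by (intro anc_edge[OF r]) auto
      then show ?thesis using True E_sym unfolding a2_def by (simp del: funpow.simps)
    next
      case False
      have "E (anc r (Suc (J + 2 * I - Suc t)) u3) (anc r (J + 2 * I - Suc t) u3)"
        using False IkJ J uc that by (intro anc_edge[OF r]) auto
      moreover have "a2 t = anc r (J + 2 * I - t) u3"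
        using False I unfolding a2_def by (cases "t = I") (auto simp: mult_2)
      moreover have "Suc (J + 2 * I - Suc t) = J + 2 * I - t"
        using that J by simp
      ultimately show ?thesis using False unfolding a2_def by (simp del: funpow.simps)
    qed
    ultimately show ?thesis using i3[OF that(1)] unfolding a_def by auto
  qed
  have d01: "s = t \<and> s = 0" if "anc r (J - s) u1 = anc r (J - t) u2" "s \<le> n" "t \<le> n" for s t
  proof -
    have "s = t" using arg_cong[OF that(1), of "lev r"] lev01(1)[OF that(2)] lev01(2)[OF that(3)] by simp
    then show ?thesis using that distinct[of "J - s"] J by (cases "s = 0") auto
  qed
  have d2: "s = t \<and> s = 0"
    if "anc r (J - s) u = a2 t" "s \<le> n" "t \<le> n" and u: "u = u1 \<or> u = u2" for s t u
  proof -
    have le: "k - J + s = (if t \<le> I then k - J - t else k - J + t - 2 * I)"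
      using arg_cong[OF that(1), of "lev r"] lev01[OF that(2)] lev2[OF that(3)] u by metis
    show ?thesis
    proof (cases "t \<le> I")
      case True
      then show ?thesis using le IkJ by auto
    next
      case False
      then have ts: "t = s + 2 * I" using le IkJ by auto
      then have *: "anc r (J - s) u = anc r (J - s) u3"
        using that(1) False unfolding a2_def by (auto split: if_splits)
      have "s = 0"
        using * distinct[of "J - s"] J u by (cases "s = 0") auto
      then have "anc r (J + 0) u1 = anc r (J + 0) u3"
        using * u J(3) by auto
      then have "I = 0" using I_le by blast
      then show ?thesis using ts \<open>s = 0\<close> by simp
    qed
  qed
  have d22': False if "a2 s = a2 t" "s \<le> n" "t \<le> n" "s \<le> I" "I < t" for s t
  proof -
    have "s + t = 2 * I"
      using arg_cong[OF that(1), of "lev r"] lev2[OF that(2)] lev2[OF that(3)] that(4,5) IkJ by simp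
    then have "2 * I - t = s" by simp
    then have "anc r (J + s) u1 = anc r (J + s) u3"
      using that \<open>s + t = 2 * I\<close> unfolding a2_def by (metis Nat.add_diff_assoc le_add2 not_le)
    then show False using I_le[of s] that \<open>s + t = 2 * I\<close> by simp
  qed
  have d22: "s = t" if "a2 s = a2 t" "s \<le> n" "t \<le> n" for s t
  proof (cases "s \<le> I \<longleftrightarrow> t \<le> I")
    case True
    then show ?thesis
      using arg_cong[OF that(1), of "lev r"] lev2[OF that(2)] lev2[OF that(3)] IkJ by (auto split: if_splits)
  next
    case False
    then show ?thesis using d22'[OF that] d22'[OF that(1)[symmetric] that(3,2)] by auto
  qed
  have inj: "s = t \<and> (s = 0 \<or> i = j)" if "a i s = a j t" "i < 3" "j < 3" "s \<le> n" "t \<le> n" for i j s t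
  proof -
    have same: "s = t" if "anc r (J - s) u1 = anc r (J - t) u1 \<or> anc r (J - s) u2 = anc r (J - t) u2"
      using that arg_cong[of "anc r (J - s) u1" "anc r (J - t) u1" "lev r"]
        arg_cong[of "anc r (J - s) u2" "anc r (J - t) u2" "lev r"]
        lev01[OF \<open>s \<le> n\<close>] lev01[OF \<open>t \<le> n\<close>] by linarith
    have a: "a 0 v = anc r (J - v) u1" "a 1 v = anc r (J - v) u2" "a 2 v = a2 v" for v
      unfolding a_def by auto
    have "s = t" if "a 0 s = a 0 t" using that same unfolding a by blast
    moreover have "s = t" if "a 1 s = a 1 t" using that same unfolding a by blast
    moreover have "s = t" if "a 2 s = a 2 t" using d22 that \<open>s \<le> n\<close> \<open>t \<le> n\<close> unfolding a by blast
    moreover have "s = t \<and> s = 0" if "a 0 s = a 1 t"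
      using d01 that \<open>s \<le> n\<close> \<open>t \<le> n\<close> unfolding a by blast
    moreover have "s = t \<and> s = 0" if "a 1 s = a 0 t"
      using d01[OF that[symmetric, unfolded a] \<open>t \<le> n\<close> \<open>s \<le> n\<close>] by simp
    moreover have "s = t \<and> s = 0" if "a 0 s = a 2 t"
      using d2[OF that[unfolded a] \<open>s \<le> n\<close> \<open>t \<le> n\<close>] by simp
    moreover have "s = t \<and> s = 0" if "a 1 s = a 2 t"
      using d2[OF that[unfolded a] \<open>s \<le> n\<close> \<open>t \<le> n\<close>] by simp
    moreover have "s = t \<and> s = 0" if "a 2 s = a 0 t"
      using d2[OF that[symmetric, unfolded a] \<open>t \<le> n\<close> \<open>s \<le> n\<close>] by simp
    moreover have "s = t \<and> s = 0" if "a 2 s = a 1 t"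
      using d2[OF that[symmetric, unfolded a] \<open>t \<le> n\<close> \<open>s \<le> n\<close>] by simp
    ultimately show ?thesis
      using i3[OF that(2)] i3[OF that(3)] that(1) by (elim disjE) simp_all
  qed
  have "spider n a"
    unfolding spider_def using V root edge inj by blast
  then show ?thesis by blast
qed

text \<open>
  The three ancestral paths end at the root, so two of them meet; the legs of the spider are long
  because the first meeting is more than n steps up.
\<close>

lemma spider_of_three:
  assumes r: "r \<in> V" and u: "u1 \<in> layer r k" "u2 \<in> layer r k" "u3 \<in> layer r k"
    and ne: "anc r n u1 \<noteq> anc r n u2" "anc r n u1 \<noteq> anc r n u3" "anc r n u2 \<noteq> anc r n u3"
  shows "\<exists>a. spider n a"
proof -
  define nd where "nd m \<longleftrightarrow> anc r m u1 = anc r m u2 \<or> anc r m u1 = anc r m u3 \<or> anc r m u2 = anc r m u3" for m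
  \<comment> \<open>the first generation in which two of the three paths meet\<close>
  define J where "J = (LEAST m. nd m)"
  have "nd k"
    using anc_root[OF r, of u1 k] anc_root[OF r, of u2 k] u unfolding nd_def layer_def by auto
  then have J: "nd J" "J \<le> k" unfolding J_def by (auto intro: LeastI Least_le)
  have "\<not> nd m" if "m < J" for m
    using that not_less_Least unfolding J_def by blast
  then have d: "anc r m u1 \<noteq> anc r m u2 \<and> anc r m u1 \<noteq> anc r m u3 \<and> anc r m u2 \<noteq> anc r m u3"
    if "m < J" for m
    using that unfolding nd_def by blast
  have "n < J"
  proof (rule ccontr)
    assume "\<not> n < J"
    then have "n = (n - J) + J" by simp
    then have "anc r n u = anc r (n - J) (anc r J u)" for u using anc_add by metis
    then show False using ne J(1) unfolding nd_def by metis
  qed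
  show ?thesis
    using J(1) unfolding nd_def
  proof (elim disjE)
    assume "anc r J u1 = anc r J u2"
    then show ?thesis using spider_of_merge[OF r u(1,2,3) \<open>n < J\<close> J(2)] d by blast
  next
    assume "anc r J u1 = anc r J u3"
    then show ?thesis using spider_of_merge[OF r u(1,3,2) \<open>n < J\<close> J(2)] d by metis
  next
    assume "anc r J u2 = anc r J u3"
    then show ?thesis using spider_of_merge[OF r u(2,3,1) \<open>n < J\<close> J(2)] d by metis
  qed
qed

lemma card_anc_fibre:
  assumes r: "r \<in> V" and deg: "\<And>v. v \<in> V \<Longrightarrow> card (nbrs v) < D"
  shows "w \<in> component r \<Longrightarrow> card {u \<in> component r. anc r m u = w} \<le> D ^ m"
proof (induction m arbitrary: w)
  case 0
  have "{u \<in> component r. anc r 0 u = w} \<subseteq> {w}" by auto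
  then show ?case using card_mono[of "{w}"] by fastforce
next
  case (Suc m)
  have finC: "finite (component r)" using component_subset[OF r] finV finite_subset by blast
  let ?A = "{u \<in> component r. anc r m u = w}"
  have eq: "{u \<in> component r. anc r (Suc m) u = w} \<subseteq> (\<Union>v\<in>?A. insert v (nbrs v))"
  proof
    fix u assume "u \<in> {u \<in> component r. anc r (Suc m) u = w}"
    then have u: "u \<in> component r" "anc r m (parent r u) = w"
      by (auto simp: funpow_swap1)
    have "u \<in> insert (parent r u) (nbrs (parent r u))"
      using parent(2)[OF r u(1)] u component_subset[OF r]
      by (cases "lev r u = 0") (auto simp: parent_def nbrs_def)
    then show "u \<in> (\<Union>v\<in>?A. insert v (nbrs v))"
      using parent_component[OF r u(1)] u(2) by blast
  qed
  have "card {u \<in> component r. anc r (Suc m) u = w} \<le> card (\<Union>v\<in>?A. insert v (nbrs v))"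
    using finC finite_nbrs by (intro card_mono eq) auto
  also have "\<dots> \<le> (\<Sum>v\<in>?A. card (insert v (nbrs v)))"
    using finC by (intro card_UN_le) auto
  also have "\<dots> \<le> (\<Sum>v\<in>?A. D)"
  proof (intro sum_mono)
    fix v assume "v \<in> ?A"
    then have "card (nbrs v) < D" using deg component_subset[OF r] by auto
    then show "card (insert v (nbrs v)) \<le> D"
      by (simp add: card_insert_if finite_nbrs)
  qed
  also have "\<dots> \<le> D ^ m * D"
    using Suc.IH[OF Suc.prems] by simp
  finally show ?case by (simp add: mult.commute)
qed

text \<open>
  Going up n generations maps a layer to at most two vertices, since three would give a spider, and
  each of these has at most D^n descendants n generations below.
\<close>

lemma card_layer_le:
  assumes r: "r \<in> V" and deg: "\<And>v. v \<in> V \<Longrightarrow> card (nbrs v) < D"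
    and no: "\<nexists>a. spider n a"
  shows "card (layer r k) \<le> 2 * D ^ n"
proof -
  have finC: "finite (component r)" using component_subset[OF r] finV finite_subset by blast
  have finL: "finite (layer r k)" unfolding layer_def using finC by simp
  let ?P = "anc r n ` layer r k"
  have "card ?P \<le> 2"
  proof (rule ccontr)
    assume "\<not> card ?P \<le> 2"
    then have "3 \<le> card ?P" by simp
    then obtain Q where Q: "Q \<subseteq> ?P" "card Q = 3" by (rule obtain_subset_with_card_n)
    then obtain x y z where "Q = {x, y, z}" "x \<noteq> y" "x \<noteq> z" "y \<noteq> z"
      by (auto simp: card_3_iff)
    then obtain u1 u2 u3 where "u1 \<in> layer r k" "u2 \<in> layer r k" "u3 \<in> layer r k"
      "anc r n u1 = x" "anc r n u2 = y" "anc r n u3 = z"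
      using Q(1) by auto
    then show False
      using spider_of_three[OF r, of u1 k u2 u3 n] no \<open>x \<noteq> y\<close> \<open>x \<noteq> z\<close> \<open>y \<noteq> z\<close> by blast
  qed
  have "card (layer r k) \<le> card (\<Union>w\<in>?P. {u \<in> component r. anc r n u = w})"
    using finL finC by (intro card_mono) (auto simp: layer_def)
  also have "\<dots> \<le> (\<Sum>w\<in>?P. card {u \<in> component r. anc r n u = w})"
    using finL by (intro card_UN_le) auto
  also have "\<dots> \<le> (\<Sum>w\<in>?P. D ^ n)"
    using anc_component[OF r] by (intro sum_mono card_anc_fibre[OF r deg]) (auto simp: layer_def)
  also have "\<dots> \<le> 2 * D ^ n"
    using \<open>card ?P \<le> 2\<close> by simp
  finally show ?thesis .
qed

end

section \<open>Determining sets\<close>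

context shifted_graph
begin

definition restrict_to :: "'a set \<Rightarrow> ('a \<Rightarrow> real) \<Rightarrow> 'a \<Rightarrow> real" where
  "restrict_to X x u = (if u \<in> X then x u else 0)"

lemma supported_restrict: "supported (restrict_to X x) X"
  unfolding supported_def restrict_to_def by simp

lemma supported_mono: "supported x X \<Longrightarrow> X \<subseteq> Y \<Longrightarrow> supported x Y"
  unfolding supported_def by blast

lemma form_split:
  assumes "\<And>u v. u \<in> V \<Longrightarrow> v \<in> V \<Longrightarrow> u \<in> X \<Longrightarrow> v \<notin> X \<Longrightarrow> x u \<noteq> 0 \<Longrightarrow> x v \<noteq> 0 \<Longrightarrow> \<not> E u v"
  shows "form x = form (restrict_to X x) + form (restrict_to (- X) x)"
proof -
  have "x = (\<lambda>u. 1 * restrict_to X x u + 1 * restrict_to (- X) x u)"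
    unfolding restrict_to_def by auto
  then have "form x = form (\<lambda>u. 1 * restrict_to X x u + 1 * restrict_to (- X) x u)"
    by simp
  also have "\<dots> = form (restrict_to X x) + form (restrict_to (- X) x)"
    unfolding form_lin using assms
    by (subst bil_separated) (auto simp: restrict_to_def split: if_splits)
  finally show ?thesis .
qed

lemma form_split_component: "r \<in> V \<Longrightarrow> form x = form (restrict_to (component r) x) + form (restrict_to (- component r) x)"
  using component_step by (intro form_split) blast

text \<open>
  A vector with negative form and smallest possible support cannot be spread over two components,
  because the form is additive over components.
\<close>

lemma negative_in_component:
  assumes "form x < 0"
  shows "\<exists>r\<in>V. \<exists>y. supported y (component r) \<and> form y < 0"
proof -
  define P where "P X \<longleftrightarrow> X \<subseteq> V \<and> (\<exists>y. supported y X \<and> form y < 0)" for X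
  have "form (restrict_to V x) = form x"
    by (rule form_cong) (simp add: restrict_to_def)
  then have "P V"
    unfolding P_def using assms supported_restrict[of V x] by auto
  from ex_has_least_nat[of P, OF this] obtain X
    where X: "P X" and min: "\<And>Y. P Y \<Longrightarrow> card X \<le> card Y" by blast
  obtain y where y: "supported y X" "form y < 0" and XV: "X \<subseteq> V" using X unfolding P_def by blast
  have "X \<noteq> {}"
  proof
    assume "X = {}"
    then have "y u = 0" for u using y(1) unfolding supported_def by simp
    then show False using y(2) unfolding form_expand by simp
  qed
  then obtain r where r: "r \<in> X" "r \<in> V" using XV by blast
  have "\<not> P (X - {r})"
    using min[of "X - {r}"] r finite_subset[OF XV finV] by (metis card_Diff1_less not_le)
  have "0 \<le> form (restrict_to (- component r) y)"
  proof (rule ccontr)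
    assume "\<not> 0 \<le> form (restrict_to (- component r) y)"
    moreover have "supported (restrict_to (- component r) y) (X - {r})"
      using y(1) component_refl unfolding supported_def restrict_to_def by auto
    ultimately have "P (X - {r})"
      unfolding P_def using XV by (auto simp: not_le)
    with \<open>\<not> P (X - {r})\<close> show False by blast
  qed
  then have "form (restrict_to (component r) y) < 0"
    using form_split_component[OF r(2), of y] y(2) by simp
  then show ?thesis using r(2) supported_restrict by blast
qed

end

context equiangular_graph
begin

text \<open>
  A vector that vanishes on the spider and on its neighbours is separated from a vector on the
  spider with negative form.
\<close>

lemma determining_set_of_spider:
  assumes sp: "spider n a" and lam: "lam \<le> l0" and n: "3 * (1 / sqrt 2) * (1 / 2) ^ n < 3 / sqrt 2 - l0"
    and deg: "\<And>v. v \<in> V \<Longrightarrow> card (nbrs v) < D"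
  shows "\<exists>U\<subseteq>V. card U \<le> 3 * (n + 1) * D \<and>
    (\<forall>x. form x \<le> 0 \<longrightarrow> (\<forall>u\<in>U. x u = 0) \<longrightarrow> (\<forall>u\<in>V. x u = 0))"
proof -
  obtain b where b: "supported b (spider_set n a)" "form b < 0"
    using spider_negative[OF sp lam n] by blast
  define B where "B = spider_set n a"
  have BV: "B \<subseteq> V" using sp unfolding B_def spider_set_def spider_def by auto
  define U where "U = (\<Union>u\<in>B. insert u (nbrs u))"
  have "card U \<le> (\<Sum>u\<in>B. card (insert u (nbrs u)))"
    unfolding U_def using finite_subset[OF BV finV] by (intro card_UN_le)
  also have "\<dots> \<le> (\<Sum>u\<in>B. D)"
  proof (intro sum_mono)
    fix v assume "v \<in> B"
    then have "card (nbrs v) < D" using deg BV by auto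
    then show "card (insert v (nbrs v)) \<le> D"
      by (simp add: card_insert_if finite_nbrs)
  qed
  also have "\<dots> \<le> 3 * (n + 1) * D"
    using card_spider_set[of n a] unfolding B_def by simp
  finally have card: "card U \<le> 3 * (n + 1) * D" .
  have "U \<subseteq> V" unfolding U_def using BV by (auto simp: nbrs_def)
  have "x u = 0" if "form x \<le> 0" "\<forall>u\<in>U. x u = 0" "u \<in> V" for x u
  proof (rule separated_from_negative[OF b(2) that(1) _ that(3)])
    fix p q assume "p \<in> V" "q \<in> V" "b p \<noteq> 0" "x q \<noteq> 0"
    then have "p \<in> B" "q \<notin> U"
      using b(1) that(2) unfolding supported_def B_def by auto
    then show "p \<noteq> q \<and> \<not> E p q"
      using \<open>q \<in> V\<close> unfolding U_def nbrs_def by auto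
  qed
  then show ?thesis using card \<open>U \<subseteq> V\<close> by blast
qed

text \<open>
  Let k be the least radius for which the form takes a negative value on the ball around r. A vector x
  that vanishes on the layers k and k + 1 splits into a part inside the ball of radius k - 1, where the
  form is nonnegative, and a part separated from the ball of radius k. The outer part vanishes by the
  separation principle. The inner part is then a null vector; it vanishes at the root, and the
  zero spreads through the ball.
\<close>

lemma determining_set_of_layers:
  assumes no: "\<nexists>a. spider n a" and deg: "\<And>v. v \<in> V \<Longrightarrow> card (nbrs v) < D"
    and neg: "form z < 0"
  shows "\<exists>U\<subseteq>V. card U \<le> 4 * D ^ n + 1 \<and>
    (\<forall>x. form x \<le> 0 \<longrightarrow> (\<forall>u\<in>U. x u = 0) \<longrightarrow> (\<forall>u\<in>V. x u = 0))"
proof -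
  obtain r y where r: "r \<in> V" and y: "supported y (component r)" "form y < 0"
    using negative_in_component[OF neg] by blast
  define heavy where "heavy k \<longleftrightarrow> (\<exists>y. supported y (bfs_ball r k) \<and> form y < 0)" for k
  have finC: "finite (component r)" using component_subset[OF r] finV finite_subset by blast
  have "component r \<subseteq> bfs_ball r (Max (lev r ` component r))"
    using finC bfs_ball_iff_lev[OF r] by auto
  then have "heavy (Max (lev r ` component r))"
    unfolding heavy_def using y supported_mono by blast
  define k where "k = (LEAST k. heavy k)"
  have k: "heavy k" unfolding k_def by (rule LeastI, fact)
  have light: "\<not> heavy j" if "j < k" for j using that not_less_Least unfolding k_def by blast
  have "k \<noteq> 0"
  proof
    assume "k = 0"
    then obtain y where y: "supported y {r}" "form y < 0" using k unfolding heavy_def by auto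
    have "y = (\<lambda>u. y r * of_bool (u = r))"
      using y(1) unfolding supported_def by auto
    then have "form y = (y r)\<^sup>2 * lam"
      using form_scale[of "y r" "\<lambda>u. of_bool (u = r)"] form_unit[OF r] by simp
    then show False using y(2) lam_nonneg by (simp add: mult_less_0_iff)
  qed
  then obtain j where j: "k = Suc j" by (cases k) auto
  obtain b where b: "supported b (bfs_ball r (Suc j))" "form b < 0"
    using k unfolding heavy_def j by blast
  have nonneg: "0 \<le> form y" if "supported y (bfs_ball r j)" for y
    using light[of j] j that unfolding heavy_def by (auto simp: not_less)
  define U where "U = insert r (layer r (Suc j) \<union> layer r (Suc (Suc j)))"
  have "card U \<le> Suc (card (layer r (Suc j) \<union> layer r (Suc (Suc j))))"
    unfolding U_def by (rule card_insert_le_m1) auto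
  also have "\<dots> \<le> Suc (card (layer r (Suc j)) + card (layer r (Suc (Suc j))))"
    using card_Un_le by simp
  also have "\<dots> \<le> 4 * D ^ n + 1"
    using card_layer_le[OF r deg no, of "Suc j"] card_layer_le[OF r deg no, of "Suc (Suc j)"] by simp
  finally have card: "card U \<le> 4 * D ^ n + 1" .
  have "U \<subseteq> V" unfolding U_def layer_def using component_subset[OF r] r by auto
  have beyond: "q \<notin> bfs_ball r (Suc (Suc j))" if "q \<notin> bfs_ball r j" "q \<notin> U" for q
    using that bfs_ball_iff_lev[OF r, of q j] bfs_ball_iff_lev[OF r, of q "Suc (Suc j)"]
    unfolding U_def layer_def by (auto simp: le_Suc_eq simp del: bfs_ball.simps)
  have "x u = 0" if x: "form x \<le> 0" "\<forall>u\<in>U. x u = 0" and u: "u \<in> V" for x u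
  proof -
    let ?x1 = "restrict_to (bfs_ball r j) x" and ?x2 = "restrict_to (- bfs_ball r j) x"
    have out: "q \<notin> bfs_ball r (Suc (Suc j))" if "?x2 q \<noteq> 0" for q
      using that x(2) beyond[of q] unfolding restrict_to_def by (auto split: if_splits simp del: bfs_ball.simps)
    have "form x = form ?x1 + form ?x2"
    proof (rule form_split)
      fix p q assume "q \<in> V" "p \<in> bfs_ball r j" "q \<notin> bfs_ball r j" "x q \<noteq> 0"
      then have "?x2 q \<noteq> 0" unfolding restrict_to_def by simp
      from out[OF this] show "\<not> E p q"
        using bfs_ball_step[OF \<open>p \<in> bfs_ball r j\<close> \<open>q \<in> V\<close>] bfs_ball_Suc[of r "Suc j"] by blast
    qed
    moreover have "0 \<le> form ?x1" by (rule nonneg[OF supported_restrict])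
    ultimately have "form ?x2 \<le> 0" using x(1) by simp
    have x2: "?x2 v = 0" if "v \<in> V" for v
    proof (rule separated_from_negative[OF b(2) \<open>form ?x2 \<le> 0\<close> _ that])
      fix p q assume "p \<in> V" "q \<in> V" "b p \<noteq> 0" "?x2 q \<noteq> 0"
      then have "p \<in> bfs_ball r (Suc j)" "q \<notin> bfs_ball r (Suc (Suc j))"
        using b(1) out unfolding supported_def by blast+
      then show "p \<noteq> q \<and> \<not> E p q"
        using bfs_ball_step[of p r "Suc j" q] \<open>q \<in> V\<close> bfs_ball_Suc[of r "Suc j"] by blast
    qed
    have "form ?x1 = form x"
    proof (rule form_cong)
      fix v assume "v \<in> V"
      from x2[OF this] show "?x1 v = x v"
        unfolding restrict_to_def by (simp split: if_splits)
    qed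
    then have x1: "form ?x1 = 0"
      using x(1) \<open>0 \<le> form ?x1\<close> by simp
    have "?x1 v = 0" if "v \<in> bfs_ball r i" "i \<le> j" for v i
      using that
    proof (induction i arbitrary: v)
      case 0
      then show ?case using x(2) unfolding U_def restrict_to_def by simp
    next
      case (Suc i)
      then consider "v \<in> bfs_ball r i" | w where "w \<in> bfs_ball r i" "v \<in> V" "E w v"
        by (auto simp: nbrs_def)
      then show ?case
      proof cases
        case 2
        moreover have "w \<in> bfs_ball r j" "w \<in> V"
          using 2 Suc.prems bfs_ball_mono[of i j r] bfs_ball_subset[OF r, of i] by auto
        ultimately show ?thesis
          using null_vector_zero_spreads[OF nonneg x1 supported_restrict, of w v] Suc by simp
      qed (use Suc in simp)
    qed
    from this[of u j] have "?x1 u = 0" unfolding restrict_to_def by auto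
    then show ?thesis using x2[OF u] unfolding restrict_to_def by (simp split: if_splits)
  qed
  then show ?thesis using card \<open>U \<subseteq> V\<close> by blast
qed

end

context shifted_graph
begin

text \<open>
  When the form is nonnegative, these are the components whose largest eigenvalue is \<lambda>.
\<close>

definition null_components :: "'a set set" where
  "null_components = {component r | r. r \<in> V \<and> (\<exists>y. supported y (component r) \<and> form y = 0 \<and> (\<exists>u\<in>V. y u \<noteq> 0))}"

lemma finite_null_components: "finite null_components"
  using finite_subset[of null_components "component ` V"] finV unfolding null_components_def by auto

lemma card_null_components:
  assumes "\<And>C. C \<in> null_components \<Longrightarrow> k \<le> card C"
  shows "card null_components * k \<le> card V"
proof -
  have sub: "C \<subseteq> V" if "C \<in> null_components" for C
    using that component_subset unfolding null_components_def by auto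
  have disj: "C \<inter> D = {}" if CD: "C \<in> null_components" "D \<in> null_components" "C \<noteq> D" for C D
  proof (rule ccontr)
    assume "C \<inter> D \<noteq> {}"
    then obtain u where "u \<in> C" "u \<in> D" by blast
    then have "C = component u" "D = component u"
      using CD component_eq unfolding null_components_def by blast+
    then show False using CD by simp
  qed
  have "card null_components * k = (\<Sum>C\<in>null_components. k)" by simp
  also have "\<dots> \<le> (\<Sum>C\<in>null_components. card C)"
    using assms by (rule sum_mono)
  also have "\<dots> = card (\<Union>null_components)"
    using disj finite_subset[OF sub finV] by (intro card_Union_disjoint[symmetric])
      (simp_all add: pairwise_def disjnt_def)
  also have "\<dots> \<le> card V"
    using sub finV by (intro card_mono) auto
  finally show ?thesis .
qed

lemma zero_spreads_in_component:
  assumes nonneg: "\<And>x. 0 \<le> form x" and y: "form y = 0" and u: "u \<in> V" "y u = 0" and w: "w \<in> component u"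
  shows "y w = 0"
proof -
  from w have "(u, w) \<in> arc_rel\<^sup>*" unfolding component_def by simp
  then show ?thesis
  proof (induction rule: rtrancl_induct)
    case (step p q)
    then show ?case
      using null_vector_zero_spreads[of UNIV y p q] nonneg y unfolding arc_rel_def supported_def by auto
  qed (rule u(2))
qed

text \<open>
  One vertex from each component carrying a null vector determines the null vectors, since a zero of
  such a vector spreads over its component. One component can be omitted: a null vector
  supported on it has constant sign, so the condition that the entries sum to zero already excludes it.
\<close>

lemma determining_set_of_nonneg:
  assumes nonneg: "\<And>x. 0 \<le> form x"
  shows "\<exists>U\<subseteq>V. card U \<le> card null_components - 1 \<and>
    (\<forall>x. form x = 0 \<longrightarrow> (\<Sum>u\<in>V. x u) = 0 \<longrightarrow> (\<forall>u\<in>U. x u = 0) \<longrightarrow> (\<forall>u\<in>V. x u = 0))"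
proof -
  have part: "form (restrict_to (component r) x) = 0" if "form x = 0" "r \<in> V" for x r
    using form_split_component[OF that(2), of x] nonneg[of "restrict_to (component r) x"]
      nonneg[of "restrict_to (- component r) x"] that(1) by simp
  have mem: "component u \<in> null_components" if "form x = 0" "u \<in> V" "x u \<noteq> 0" for x u
    unfolding null_components_def using that part[OF that(1,2)] supported_restrict component_refl[of u]
    by (fastforce simp: restrict_to_def)
  \<comment> \<open>the component left without a representative in the determining set\<close>
  define C1 where "C1 = (SOME C. C \<in> null_components)"
  define rep where "rep C = (SOME r. r \<in> V \<and> C = component r)" for C
  have rep: "rep C \<in> V" "component (rep C) = C" if "C \<in> null_components" for C
  proof -
    have "\<exists>r. r \<in> V \<and> C = component r" using that unfolding null_components_def by blast
    from someI_ex[OF this] show "rep C \<in> V" "component (rep C) = C" unfolding rep_def by auto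
  qed
  define U where "U = rep ` (null_components - {C1})"
  have "card U \<le> card (null_components - {C1})"
    unfolding U_def using finite_null_components by (intro card_image_le) auto
  also have "\<dots> \<le> card null_components - 1"
  proof (cases "null_components = {}")
    case False
    then have "C1 \<in> null_components" unfolding C1_def by (simp add: some_in_eq)
    then show ?thesis using finite_null_components by simp
  qed simp
  finally have "card U \<le> card null_components - 1" .
  moreover have "U \<subseteq> V" unfolding U_def using rep(1) by auto
  moreover have "x u = 0" if x: "form x = 0" "(\<Sum>u\<in>V. x u) = 0" "\<forall>u\<in>U. x u = 0" and u: "u \<in> V" for x u
  proof (rule ccontr)
    assume "x u \<noteq> 0"
    have C1: "component v = C1" if "v \<in> V" "x v \<noteq> 0" for v
    proof (rule ccontr)
      assume "component v \<noteq> C1"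
      then have "x (rep (component v)) = 0" and r: "rep (component v) \<in> V" "component (rep (component v)) = component v"
        using mem[OF x(1) that] rep x(3) unfolding U_def by auto
      then have "x v = 0"
        using zero_spreads_in_component[OF nonneg x(1), of "rep (component v)" v] component_refl[of v] by auto
      with that(2) show False by simp
    qed
    \<comment> \<open>up to a factor 2, the part of x whose sign is opposite to the sign at u\<close>
    define w where "w v = 1 * \<bar>x v\<bar> + (- sgn (x u)) * x v" for v
    have "supported x UNIV" unfolding supported_def by simp
    then have "form (\<lambda>v. \<bar>x v\<bar>) = 0"
      using null_vector_abs[of UNIV x] nonneg x(1) by blast
    then have "defect w v = 0" if "v \<in> V" for v
      unfolding w_def[abs_def] defect_lin
      using null_vector_defect[of UNIV _ v] nonneg x(1) that by (simp add: supported_def)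
    then have "form w = 0" by (rule form_eq_0_if_defect)
    moreover have "w u = 0"
      unfolding w_def by (simp add: sgn_if)
    ultimately have "w v = 0" if "v \<in> component u" for v
      using zero_spreads_in_component[OF nonneg _ u] that by blast
    then have "w v = 0" if "v \<in> V" for v
      using that C1[OF that] C1[OF u \<open>x u \<noteq> 0\<close>] component_refl[of v] by (cases "x v = 0") (auto simp: w_def)
    then have "(\<Sum>v\<in>V. w v) = 0" by simp
    then have "(\<Sum>v\<in>V. \<bar>x v\<bar>) = 0"
      using x(2) unfolding w_def by (simp add: sum_subtractf flip: sum_distrib_left)
    then have "\<bar>x u\<bar> = 0"
      using finV u by (subst (asm) sum_nonneg_eq_0_iff) auto
    with \<open>x u \<noteq> 0\<close> show False by simp
  qed
  ultimately show ?thesis by blast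
qed

end

section \<open>The spectral radius order\<close>

context shifted_graph
begin

text \<open>
  Transport C to an initial segment of the natural numbers. The null vector becomes an eigenvector
  for \<lambda>, and evaluating the form on the eigenvector of any other eigenvalue shows that \<lambda> is the largest.
\<close>

lemma order_le_card:
  assumes C: "C \<subseteq> V" and nonneg: "\<And>x. supported x C \<Longrightarrow> 0 \<le> form x"
    and y: "supported y C" "form y = 0" "u \<in> V" "y u \<noteq> 0"
  shows "spectral_radius_order lam \<le> enat (card C)"
proof -
  have finC: "finite C" using C finV finite_subset by blast
  define n where "n = card C"
  obtain f where f: "bij_betw f {..<n} C"
    using ex_bij_betw_nat_finite[OF finC] unfolding n_def atLeast0LessThan by blast
  have fC: "f i \<in> C" if "i < n" for i using f that bij_betwE by blast
  define g where "g = the_inv_into {..<n} f"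
  have gf: "g (f i) = i" if "i < n" for i
    unfolding g_def using f that by (simp add: the_inv_into_f_f bij_betw_def)
  define G where "G = \<lparr>pverts = {..<n}, parcs = {(i, j). i < n \<and> j < n \<and> E (f i) (f j)}\<rparr>"
  have "finite (parcs G)"
    by (rule finite_subset[of _ "{..<n} \<times> {..<n}"]) (auto simp: G_def)
  then have pg: "pair_graph G"
    by unfold_locales
      (auto simp: G_def E_irrefl symmetric_def sym_def with_proj_def arcs_ends_def arc_to_ends_def intro: E_sym)
  define A where "A = adjacency_matrix n G"
  have A: "A \<in> carrier_mat n n" unfolding A_def adjacency_matrix_def by simp
  have Av: "(A *\<^sub>v v) $ i = (\<Sum>j<n. of_bool (E (f i) (f j)) * v $ j)"
    if "i < n" "v \<in> carrier_vec n" for i v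
    using that unfolding A_def adjacency_matrix_def
    by (auto simp: scalar_prod_def G_def atLeast0LessThan of_bool_def intro!: sum.cong)
  have reindex: "(\<Sum>i<n. h (f i)) = sum h C" for h :: "'a \<Rightarrow> real"
    by (rule sum.reindex_bij_betw[OF f])
  have nbr: "nbr_sum x (f i) = (\<Sum>j<n. of_bool (E (f i) (f j)) * x (f j))" if "supported x C" for x i
    unfolding nbr_sum_def reindex[of "\<lambda>v. of_bool (E (f i) v) * x v"]
    using that C finV by (intro sum.mono_neutral_right) (auto simp: supported_def)
  have "u \<in> C" using y unfolding supported_def by blast
  then obtain i0 where i0: "i0 < n" "f i0 = u" using f unfolding bij_betw_def by auto
  have "lam \<in> spectrum A"
  proof -
    let ?v = "vec n (\<lambda>i. y (f i))"
    have "?v \<noteq> 0\<^sub>v n"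
    proof
      assume "?v = 0\<^sub>v n"
      then have "?v $ i0 = 0\<^sub>v n $ i0" by simp
      then show False using i0 y(4) by simp
    qed
    moreover have "A *\<^sub>v ?v = lam \<cdot>\<^sub>v ?v"
    proof (rule eq_vecI)
      fix i assume "i < dim_vec (lam \<cdot>\<^sub>v ?v)"
      then have i: "i < n" by simp
      have "defect y (f i) = 0"
        using null_vector_defect[OF nonneg y(2,1) fC[OF i]] C fC[OF i] by blast
      then show "(A *\<^sub>v ?v) $ i = (lam \<cdot>\<^sub>v ?v) $ i"
        using i Av[OF i, of ?v] nbr[OF y(1), of i] by (simp add: defect_def)
    qed (use A in simp)
    ultimately show ?thesis
      unfolding spectrum_def eigenvalue_def eigenvector_def using A by (auto intro!: exI[of _ ?v])
  qed
  moreover have "\<mu> \<le> lam" if mu: "\<mu> \<in> spectrum A" for \<mu>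
  proof -
    obtain v where v: "v \<in> carrier_vec n" "v \<noteq> 0\<^sub>v n" "A *\<^sub>v v = \<mu> \<cdot>\<^sub>v v"
      using mu A unfolding spectrum_def eigenvalue_def eigenvector_def by auto
    define x where "x w = (if w \<in> C then v $ g w else 0)" for w
    have xf: "x (f i) = v $ i" if "i < n" for i
      unfolding x_def using fC gf that by simp
    have sx: "supported x C" unfolding supported_def x_def by simp
    have nb: "nbr_sum x (f i) = \<mu> * v $ i" if "i < n" for i
    proof -
      have "nbr_sum x (f i) = (A *\<^sub>v v) $ i"
        unfolding nbr[OF sx] Av[OF that v(1)] by (intro sum.cong) (auto simp: xf)
      then show ?thesis using v that by simp
    qed
    have "form x = (\<Sum>w\<in>C. x w * defect x w)"
      unfolding bil_def using sx C finV by (intro sum.mono_neutral_right) (auto simp: supported_def)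
    also have "\<dots> = (\<Sum>i<n. x (f i) * defect x (f i))"
      by (rule reindex[symmetric])
    also have "\<dots> = (\<Sum>i<n. (lam - \<mu>) * (v $ i)\<^sup>2)"
      by (intro sum.cong) (auto simp: xf nb defect_def power2_eq_square algebra_simps)
    finally have "0 \<le> (lam - \<mu>) * (\<Sum>i<n. (v $ i)\<^sup>2)"
      using nonneg[OF sx] by (simp add: sum_distrib_left)
    moreover obtain j where j: "j < n" "v $ j \<noteq> 0"
      using v(1,2) by (metis carrier_vecD eq_vecI index_zero_vec)
    then have "0 < (\<Sum>i<n. (v $ i)\<^sup>2)"
      by (intro sum_pos2[of _ j]) auto
    ultimately show ?thesis by (simp add: zero_le_mult_iff)
  qed
  ultimately have "largest_eigenvalue n G = lam"
    unfolding largest_eigenvalue_def A_def[symmetric]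
    using card_finite_spectrum(1)[OF A] by (intro Max_eqI) auto
  moreover have "1 \<le> n" using i0 by simp
  moreover have "pverts G = {..<n}" unfolding G_def by simp
  ultimately show ?thesis
    unfolding spectral_radius_order_def n_def[symmetric] using pg by (intro Inf_lower) blast
qed

lemma null_component_order:
  assumes "\<And>x. 0 \<le> form x" "C \<in> null_components"
  shows "spectral_radius_order lam \<le> enat (card C)"
  using assms component_subset order_le_card unfolding null_components_def by blast

end

text \<open>
  The quadratic form of a attains its maximum on the unit sphere, a closed subset of a product of
  compact intervals.
\<close>

lemma rayleigh_maximum:
  fixes a :: "nat \<Rightarrow> nat \<Rightarrow> real"
  assumes n: "0 < n"
  shows "\<exists>y. (\<Sum>i<n. (y i)\<^sup>2) = 1 \<and>
    (\<forall>x. (\<Sum>i<n. \<Sum>j<n. a i j * x i * x j) \<le> (\<Sum>i<n. \<Sum>j<n. a i j * y i * y j) * (\<Sum>i<n. (x i)\<^sup>2))"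
proof -
  \<comment> \<open>coordinates from n on are set to zero, so that the sphere is compact in the product topology\<close>
  define B :: "nat \<Rightarrow> real set" where "B i = (if i < n then {-1..1} else {0})" for i
  define S where "S = PiE UNIV B \<inter> {x. (\<Sum>i<n. (x i)\<^sup>2) = 1}"
  define q where "q x = (\<Sum>i<n. \<Sum>j<n. a i j * x i * x j)" for x :: "nat \<Rightarrow> real"
  have "compactin (product_topology (\<lambda>i. euclidean) UNIV) (PiE UNIV B)"
    unfolding compactin_PiE by (auto simp: B_def)
  then have "compact (PiE UNIV B)"
    unfolding euclidean_product_topology by simp
  moreover have "closed {x :: nat \<Rightarrow> real. (\<Sum>i<n. (x i)\<^sup>2) = 1}"
    by (intro closed_Collect_eq continuous_intros continuous_on_product_coordinates)
  ultimately have "compact S"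
    unfolding S_def by (rule compact_Int_closed)
  moreover have "(\<lambda>i. of_bool (i = 0)) \<in> S"
    using n unfolding S_def B_def by (auto simp: of_bool_def if_distrib[of "\<lambda>c. c ^ _"] cong: if_cong)
  moreover have "continuous_on S q"
    unfolding q_def
    by (intro continuous_intros continuous_on_subset[OF continuous_on_product_coordinates]) auto
  ultimately obtain y where y: "y \<in> S" "\<forall>x\<in>S. q x \<le> q y"
    using continuous_attains_sup[of S q] by blast
  have "q x \<le> q y * (\<Sum>i<n. (x i)\<^sup>2)" for x
  proof (cases "(\<Sum>i<n. (x i)\<^sup>2) = 0")
    case True
    then have "x i = 0" if "i < n" for i
      using that by (subst (asm) sum_nonneg_eq_0_iff) auto
    then have "q x = 0" unfolding q_def by simp
    then show ?thesis using True by simp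
  next
    case False
    define r where "r = sqrt (\<Sum>i<n. (x i)\<^sup>2)"
    have pos: "0 < (\<Sum>i<n. (x i)\<^sup>2)"
      using False by (simp add: less_le sum_nonneg)
    then have r: "0 < r" "r\<^sup>2 = (\<Sum>i<n. (x i)\<^sup>2)" unfolding r_def by simp_all
    define z where "z i = (if i < n then x i / r else 0)" for i
    have "\<bar>x i\<bar> \<le> r" if "i < n" for i
      using that unfolding r_def by (intro real_le_rsqrt) (auto intro: member_le_sum)
    then have "\<bar>x i / r\<bar> \<le> 1" if "i < n" for i
      using that r(1) by simp
    then have "z i \<in> B i" for i
      unfolding z_def B_def abs_le_iff by (auto simp: minus_le_iff)
    moreover have "(\<Sum>i<n. (z i)\<^sup>2) = 1"
      using r(2) pos unfolding z_def by (simp add: power_divide flip: sum_divide_distrib)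
    ultimately have "z \<in> S" unfolding S_def by auto
    then have "q z \<le> q y" using y(2) by simp
    also have "q z = q x / r\<^sup>2"
      unfolding q_def z_def by (simp add: sum_divide_distrib power2_eq_square)
    finally show ?thesis using pos unfolding r(2) by (simp add: pos_divide_le_eq)
  qed
  moreover have "(\<Sum>i<n. (y i)\<^sup>2) = 1" using y(1) unfolding S_def by simp
  ultimately show ?thesis unfolding q_def by blast
qed

text \<open>
  By definition some graph on \<kappa> vertices has \<lambda> as its largest eigenvalue. The maximum \<mu> of its Rayleigh
  quotient is an eigenvalue, so \<mu> \<le> \<lambda>, and therefore \<lambda>I - A is positive semidefinite. One vertex does
  not suffice, as its only eigenvalue is 0.
\<close>

lemma spectral_radius_order_witness:
  assumes ord: "spectral_radius_order lam = enat \<kappa>" and lam: "0 < lam"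
  shows "2 \<le> \<kappa> \<and> (\<exists>E y. shifted_graph {..<\<kappa>} E lam \<and>
    (\<forall>x. 0 \<le> shifted_graph.bil {..<\<kappa>} E lam x x) \<and>
    (\<forall>i<\<kappa>. shifted_graph.defect {..<\<kappa>} E lam y i = 0) \<and> (\<exists>i<\<kappa>. y i \<noteq> 0))"
proof -
  let ?S = "{enat n | n. n \<ge> 1 \<and>
       (\<exists>G. pair_graph G \<and> pverts G = {..<n} \<and> largest_eigenvalue n G = lam)}"
  have ne: "?S \<noteq> {}"
    using ord unfolding spectral_radius_order_def by (auto simp: Inf_enat_def split: if_splits)
  then obtain z where "z \<in> ?S" by blast
  then have "(LEAST x. x \<in> ?S) \<in> ?S" by (rule LeastI)
  moreover have "Inf ?S = (LEAST x. x \<in> ?S)"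
    using ne by (simp only: Inf_enat_def if_False)
  ultimately have "enat \<kappa> \<in> ?S"
    using ord unfolding spectral_radius_order_def by simp
  then obtain G where k: "1 \<le> \<kappa>" and G: "pair_graph G" "pverts G = {..<\<kappa>}" "largest_eigenvalue \<kappa> G = lam"
    by auto
  interpret pair_graph G by fact
  define E where "E i j \<longleftrightarrow> (i, j) \<in> parcs G" for i j
  have E: "E j i" if "E i j" for i j
    using that sym_arcs arcs_symmetric unfolding E_def by blast
  have irr: "\<not> E i i" for i using pair_no_loops[of "(i, i)"] unfolding E_def by auto
  define A where "A = adjacency_matrix \<kappa> G"
  have A: "A \<in> carrier_mat \<kappa> \<kappa>" unfolding A_def adjacency_matrix_def by simp
  have Av: "(A *\<^sub>v v) $ i = (\<Sum>j<\<kappa>. of_bool (E i j) * v $ j)"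
    if "i < \<kappa>" "v \<in> carrier_vec \<kappa>" for i v
    using that unfolding A_def adjacency_matrix_def
    by (auto simp: scalar_prod_def E_def atLeast0LessThan of_bool_def intro!: sum.cong)
  have "0 < \<kappa>" using k by simp
  from rayleigh_maximum[OF this, of "\<lambda>i j. of_bool (E i j)"]
  obtain y :: "nat \<Rightarrow> real" where y: "(\<Sum>i<\<kappa>. (y i)\<^sup>2) = 1"
    and max: "\<forall>x. (\<Sum>i<\<kappa>. \<Sum>j<\<kappa>. of_bool (E i j) * x i * x j)
      \<le> (\<Sum>i<\<kappa>. \<Sum>j<\<kappa>. of_bool (E i j) * y i * y j) * (\<Sum>i<\<kappa>. (x i)\<^sup>2)"
    by blast
  note max = max[rule_format]
  define \<mu> where "\<mu> = (\<Sum>i<\<kappa>. \<Sum>j<\<kappa>. of_bool (E i j) * y i * y j)"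
  have "(\<Sum>i<\<kappa>. \<Sum>j<\<kappa>. of_bool (E i j) * of_bool (i = 0) * of_bool (j = 0)) = (0::real)"
    using irr by (auto intro!: sum.neutral simp: of_bool_def)
  then have "0 \<le> \<mu> * (\<Sum>i<\<kappa>. (of_bool (i = 0))\<^sup>2)"
    using max[of "\<lambda>i. of_bool (i = 0)"] unfolding \<mu>_def by simp
  also have "(\<Sum>i<\<kappa>. (of_bool (i = 0))\<^sup>2) = (1::real)"
    using k by (simp add: of_bool_def if_distrib[of "\<lambda>c. c ^ _"] cong: if_cong)
  finally have "0 \<le> \<mu>" by simp
  interpret M: shifted_graph "{..<\<kappa>}" E \<mu>
    by unfold_locales (use E irr \<open>0 \<le> \<mu>\<close> in auto)
  have Mnonneg: "0 \<le> M.form x" for x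
    using max[of x] unfolding \<mu>_def[symmetric] M.form_expand by simp
  have "M.form y = 0"
    unfolding M.form_expand y using \<mu>_def by simp
  then have My: "M.defect y i = 0" if "i < \<kappa>" for i
    using M.null_vector_defect[of UNIV y i] Mnonneg that by (simp add: M.supported_def)
  obtain i0 where i0: "i0 < \<kappa>" "y i0 \<noteq> 0"
    using y by (metis (no_types, lifting) lessThan_iff power_zero_numeral sum.neutral zero_neq_one)
  have "\<mu> \<in> spectrum A"
  proof -
    let ?v = "vec \<kappa> y"
    have "?v \<noteq> 0\<^sub>v \<kappa>"
    proof
      assume "?v = 0\<^sub>v \<kappa>"
      then have "?v $ i0 = 0\<^sub>v \<kappa> $ i0" by simp
      then show False using i0 by simp
    qed
    moreover have "A *\<^sub>v ?v = \<mu> \<cdot>\<^sub>v ?v"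
    proof (rule eq_vecI)
      fix i assume "i < dim_vec (\<mu> \<cdot>\<^sub>v ?v)"
      then show "(A *\<^sub>v ?v) $ i = (\<mu> \<cdot>\<^sub>v ?v) $ i"
        using Av[of i ?v] My[of i] by (simp add: M.defect_def M.nbr_sum_def)
    qed (use A in simp)
    ultimately show ?thesis
      unfolding spectrum_def eigenvalue_def eigenvector_def using A by (auto intro!: exI[of _ ?v])
  qed
  have fin: "finite (spectrum A)" by (rule card_finite_spectrum(1)[OF A])
  have Max: "Max (spectrum A) = lam"
    using G(3) unfolding largest_eigenvalue_def A_def .
  have "\<mu> \<le> lam" using Max_ge[OF fin \<open>\<mu> \<in> spectrum A\<close>] Max by simp
  have "lam \<in> spectrum A" using Max_in[OF fin] \<open>\<mu> \<in> spectrum A\<close> Max by auto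
  then obtain v where v: "v \<in> carrier_vec \<kappa>" "v \<noteq> 0\<^sub>v \<kappa>" "A *\<^sub>v v = lam \<cdot>\<^sub>v v"
    using A unfolding spectrum_def eigenvalue_def eigenvector_def by auto
  interpret W: shifted_graph "{..<\<kappa>}" E lam
    by unfold_locales (use E irr lam in auto)
  have "0 \<le> W.form x" for x
  proof -
    have "\<mu> * (\<Sum>u<\<kappa>. (x u)\<^sup>2) \<le> lam * (\<Sum>u<\<kappa>. (x u)\<^sup>2)"
      using \<open>\<mu> \<le> lam\<close> by (intro mult_right_mono) (auto simp: sum_nonneg)
    then show ?thesis
      using Mnonneg[of x] unfolding W.form_expand M.form_expand by simp
  qed
  moreover have Wv: "W.defect (\<lambda>i. v $ i) i = 0" if "i < \<kappa>" for i
    using Av[OF that v(1)] v that by (simp add: W.defect_def W.nbr_sum_def)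
  moreover obtain j where j: "j < \<kappa>" "v $ j \<noteq> 0"
    using v(1,2) by (metis carrier_vecD eq_vecI index_zero_vec)
  moreover have "\<kappa> \<noteq> 1"
  proof
    assume "\<kappa> = 1"
    then show False
      using Wv[of 0] j irr lam unfolding W.defect_def W.nbr_sum_def by simp
  qed
  moreover have "shifted_graph {..<\<kappa>} E lam" by unfold_locales
  ultimately show ?thesis using k by (intro conjI exI[of _ E] exI[of _ "\<lambda>i. v $ i"]) auto
qed

section \<open>Constructing equiangular lines\<close>

lemma lines_of_vectors:
  fixes u :: "'i \<Rightarrow> nat \<Rightarrow> real"
  assumes fin: "finite P" and \<alpha>: "0 < \<alpha>" "\<alpha> < 1"
    and unit: "\<And>p. p \<in> P \<Longrightarrow> (\<Sum>k<d. u p k * u p k) = 1"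
    and angle: "\<And>p q. p \<in> P \<Longrightarrow> q \<in> P \<Longrightarrow> p \<noteq> q \<Longrightarrow> \<bar>\<Sum>k<d. u p k * u q k\<bar> = \<alpha>"
  shows "\<exists>L. finite L \<and> card L = card P \<and> equiangular_lines d (arccos \<alpha>) L"
proof -
  define w where "w p = vec d (u p)" for p
  define l where "l p = line_through (w p)" for p
  have dot: "scalar_prod (a \<cdot>\<^sub>v w p) (b \<cdot>\<^sub>v w q) = a * b * (\<Sum>k<d. u p k * u q k)" for a b p q
    by (simp add: scalar_prod_def w_def atLeast0LessThan sum_distrib_left mult_ac)
  have pt: "\<exists>c. z = c \<cdot>\<^sub>v w p" if "z \<in> l p" for z p
    using that unfolding l_def line_through_def by auto
  have product: "\<bar>scalar_prod y z\<bar> = \<alpha>"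
    if that: "p \<in> P" "q \<in> P" "p \<noteq> q" and yz: "y \<in> l p" "z \<in> l q" and one: "scalar_prod y y = 1" "scalar_prod z z = 1"
    for p q y z
  proof -
    obtain a b where ab: "y = a \<cdot>\<^sub>v w p" "z = b \<cdot>\<^sub>v w q" using pt[OF yz(1)] pt[OF yz(2)] by blast
    have "a * a = 1" "b * b = 1" using one unit that(1,2) unfolding ab dot by simp_all
    then have "\<bar>a\<bar> = 1" "\<bar>b\<bar> = 1" by (auto simp: abs_if square_eq_1_iff)
    then show ?thesis
      unfolding ab dot abs_mult using angle that by simp
  qed
  have mem: "w p \<in> l p" for p
    unfolding l_def line_through_def by (rule range_eqI[of _ _ 1]) (simp add: w_def)
  have unit': "scalar_prod (w p) (w p) = 1" if "p \<in> P" for p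
    using unit[OF that] by (simp add: scalar_prod_def w_def atLeast0LessThan)
  have inj: "inj_on l P"
  proof (rule inj_onI, rule ccontr)
    fix p q assume pq: "p \<in> P" "q \<in> P" "l p = l q" "p \<noteq> q"
    then have "\<bar>scalar_prod (w p) (w p)\<bar> = \<alpha>"
      using mem[of p] unit'[of p] by (intro product[of p q]) auto
    then show False using unit'[OF pq(1)] \<alpha> by simp
  qed
  have "l p \<in> lines_through_origin d" if "p \<in> P" for p
  proof -
    have "w p \<noteq> 0\<^sub>v d"
      using unit'[OF that] by auto
    then show ?thesis
      unfolding l_def lines_through_origin_def by (auto simp: w_def)
  qed
  moreover have "arccos \<bar>scalar_prod y z\<bar> = arccos \<alpha>"
    if ab: "a \<in> l ` P" "b \<in> l ` P" and that: "a \<noteq> b" "y \<in> a" "z \<in> b" "scalar_prod y y = 1" "scalar_prod z z = 1"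
    for a b y z
  proof -
    obtain p q where pq: "p \<in> P" "q \<in> P" "a = l p" "b = l q" using ab by auto
    then have "\<bar>scalar_prod y z\<bar> = \<alpha>"
      using that by (intro product[of p q]) auto
    then show ?thesis by simp
  qed
  ultimately have "equiangular_lines d (arccos \<alpha>) (l ` P)"
    unfolding equiangular_lines_def by blast
  then show ?thesis
    using fin inj by (intro exI[of _ "l ` P"]) (auto simp: card_image)
qed

text \<open>
  A common extra coordinate contributes the J/2 term, and scaling by \<surd>(2\<alpha>) makes the vectors unit
  vectors.
\<close>

lemma lines_of_graph_vectors:
  fixes u :: "'i \<Rightarrow> nat \<Rightarrow> real"
  assumes fin: "finite P" and \<alpha>: "0 < \<alpha>" "\<alpha> < 1" and lam: "lam = (1 - \<alpha>) / (2 * \<alpha>)"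
    and irr: "\<And>p. \<not> E p p"
    and dot: "\<And>p q. p \<in> P \<Longrightarrow> q \<in> P \<Longrightarrow> (\<Sum>k<d. u p k * u q k) = lam * of_bool (p = q) - of_bool (E p q)"
  shows "\<exists>L. finite L \<and> card L = card P \<and> equiangular_lines (Suc d) (arccos \<alpha>) L"
proof -
  define w where "w p k = sqrt (2 * \<alpha>) * (if k < d then u p k else 1 / sqrt 2)" for p k
  have sq: "sqrt (2 * \<alpha>) * a * (sqrt (2 * \<alpha>) * b) = 2 * \<alpha> * (a * b)" for a b
  proof -
    have "sqrt (2 * \<alpha>) * a * (sqrt (2 * \<alpha>) * b) = (sqrt (2 * \<alpha>) * sqrt (2 * \<alpha>)) * (a * b)"
      by (simp only: mult_ac)
    also have "sqrt (2 * \<alpha>) * sqrt (2 * \<alpha>) = 2 * \<alpha>" using \<alpha> by simp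
    finally show ?thesis .
  qed
  have w: "(\<Sum>k<Suc d. w p k * w q k) = 2 * \<alpha> * ((\<Sum>k<d. u p k * u q k) + 1 / 2)" for p q
    unfolding w_def sq by (simp add: sum_distrib_left distrib_left del: real_sqrt_mult)
  have lam': "2 * \<alpha> * lam = 1 - \<alpha>" using lam \<alpha> by simp
  show ?thesis
  proof (rule lines_of_vectors[OF fin \<alpha>, where d = "Suc d" and u = w])
    show "(\<Sum>k<Suc d. w p k * w p k) = 1" if "p \<in> P" for p
      unfolding w dot[OF that that] using irr lam' by (simp add: algebra_simps)
    show "\<bar>\<Sum>k<Suc d. w p k * w q k\<bar> = \<alpha>" if "p \<in> P" "q \<in> P" "p \<noteq> q" for p q
      unfolding w dot[OF that(1,2)] using that(3) \<alpha> by (simp add: of_bool_def)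
  qed
qed

text \<open>
  Orthogonal direct sum of q copies of a configuration realising \<lambda>I - A, together with r isolated
  vertices, which are orthogonal vectors of length \<surd>\<lambda>. A pair (c, i) with c < q is the vertex i of the
  copy c, and the pairs (q, i) are the isolated vertices; coordinates are indexed in the same way and
  finally renumbered.
\<close>

lemma block_vectors:
  fixes w :: "nat \<Rightarrow> nat \<Rightarrow> real"
  assumes lam: "0 \<le> lam" and irr: "\<And>i. \<not> E i i"
    and w: "\<And>i j. i < \<kappa> \<Longrightarrow> j < \<kappa> \<Longrightarrow> (\<Sum>k<m. w i k * w j k) = lam * of_bool (i = j) - of_bool (E i j)"
  shows "\<exists>(P :: (nat \<times> nat) set) u F. finite P \<and> card P = q * \<kappa> + r \<and> (\<forall>p. \<not> F p p) \<and>
    (\<forall>p\<in>P. \<forall>p'\<in>P. (\<Sum>k<q * m + r. u p k * u p' k) = lam * of_bool (p = p') - of_bool (F p p'))"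
proof -
  define N where "N c = (if c < q then \<kappa> else r)" for c
  define D where "D c = (if c < q then m else r)" for c
  define g where "g c i k = (if c < q then w i k else sqrt lam * of_bool (i = k))" for c i k
  define P where "P = Sigma {..<Suc q} (\<lambda>c. {..<N c})"
  define K where "K = Sigma {..<Suc q} (\<lambda>c. {..<D c})"
  have "card P = q * \<kappa> + r" "card K = q * m + r"
    unfolding P_def K_def by (simp_all add: card_SigmaI N_def D_def)
  have "finite K" unfolding K_def by simp
  then obtain h where h: "bij_betw h {..<card K} K"
    using ex_bij_betw_nat_finite unfolding atLeast0LessThan by blast
  define u where "u p k = of_bool (fst p = fst (h k)) * g (fst p) (snd p) (snd (h k))"
    for p :: "nat \<times> nat" and k
  define F where "F p p' \<longleftrightarrow> fst p = fst p' \<and> fst p < q \<and> E (snd p) (snd p')" for p p' :: "nat \<times> nat"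
  have "(\<Sum>k<q * m + r. u p k * u p' k) = lam * of_bool (p = p') - of_bool (F p p')"
    if "p \<in> P" "p' \<in> P" for p p'
  proof -
    obtain c i c' i' where p: "p = (c, i)" "p' = (c', i')" by fastforce
    have ci: "c < Suc q" "i < N c" "c' < Suc q" "i' < N c'" using that unfolding p P_def by auto
    have "(\<Sum>k<q * m + r. u p k * u p' k) = (\<Sum>z\<in>K. (of_bool (c = fst z) * g c i (snd z)) * (of_bool (c' = fst z) * g c' i' (snd z)))"
      unfolding \<open>card K = q * m + r\<close>[symmetric] u_def p
      using sum.reindex_bij_betw[OF h, of "\<lambda>z. (of_bool (c = fst z) * g c i (snd z)) * (of_bool (c' = fst z) * g c' i' (snd z))"]
      by simp
    also have "\<dots> = (\<Sum>e<Suc q. \<Sum>k<D e. (of_bool (c = e) * g c i k) * (of_bool (c' = e) * g c' i' k))"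
      unfolding K_def by (subst sum.Sigma) (auto simp: case_prod_unfold)
    also have "\<dots> = (\<Sum>e<Suc q. if c = e then of_bool (c' = c) * (\<Sum>k<D c. g c i k * g c i' k) else 0)"
      by (intro sum.cong) (auto simp: of_bool_def)
    also have "\<dots> = of_bool (c' = c) * (\<Sum>k<D c. g c i k * g c i' k)"
      using ci(1) by (subst sum.delta') auto
    also have "\<dots> = lam * of_bool (p = p') - of_bool (F p p')"
    proof (cases "c' = c")
      case True
      show ?thesis
      proof (cases "c < q")
        case True
        then show ?thesis
          using \<open>c' = c\<close> ci w[of i i'] by (simp add: p g_def D_def N_def F_def)
      next
        case False
        have "(\<Sum>k<r. sqrt lam * of_bool (i = k) * (sqrt lam * of_bool (i' = k)))
            = (\<Sum>k<r. if i = k then lam * of_bool (i = i') else 0)"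
          using lam by (intro sum.cong) (auto simp: of_bool_def)
        also have "\<dots> = lam * of_bool (i = i')"
          using ci False by (subst sum.delta') (auto simp: N_def)
        finally show ?thesis
          using \<open>c' = c\<close> False by (simp add: p g_def D_def F_def)
      qed
    qed (auto simp: p F_def)
    finally show ?thesis .
  qed
  moreover have "finite P" unfolding P_def by simp
  moreover have "\<not> F p p" for p unfolding F_def using irr by simp
  ultimately show ?thesis
    using \<open>card P = q * \<kappa> + r\<close> by (intro exI[of _ P] exI[of _ u] exI[of _ F]) auto
qed

lemma many_lines:
  assumes \<alpha>: "0 < \<alpha>" "\<alpha> < 1" and lam: "lam = (1 - \<alpha>) / (2 * \<alpha>)"
    and ord: "spectral_radius_order lam = enat \<kappa>"
  shows "\<exists>L. finite L \<and> card L = q * \<kappa> + r \<and> equiangular_lines (Suc (q * (\<kappa> - 1) + r)) (arccos \<alpha>) L"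
proof -
  have lam_pos: "0 < lam" using \<alpha> lam by simp
  obtain E y where W: "shifted_graph {..<\<kappa>} E lam"
    and nonneg: "\<And>x. 0 \<le> shifted_graph.bil {..<\<kappa>} E lam x x"
    and y: "\<And>i. i < \<kappa> \<Longrightarrow> shifted_graph.defect {..<\<kappa>} E lam y i = 0" and "\<exists>i<\<kappa>. y i \<noteq> 0"
    using spectral_radius_order_witness[OF ord lam_pos] by blast
  then obtain s where s: "s < \<kappa>" "y s \<noteq> 0" by blast
  interpret shifted_graph "{..<\<kappa>}" E lam by fact
  define M where "M i j = lam * of_bool (i = j) - of_bool (E i j)" for i j
  have row: "(\<Sum>j<\<kappa>. M i j * x j) = defect x i" if "i < \<kappa>" for i x
    using that unfolding M_def defect_def nbr_sum_def
    by (simp add: left_diff_distrib sum_subtractf of_bool_def if_distrib[of "\<lambda>c. c * _"] if_distrib[of "\<lambda>c. lam * c"] cong: if_cong)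
  have "(\<Sum>i<\<kappa>. \<Sum>j<\<kappa>. M i j * x i * x j) = form x" for x
  proof -
    have "(\<Sum>i<\<kappa>. \<Sum>j<\<kappa>. M i j * x i * x j) = (\<Sum>i<\<kappa>. x i * (\<Sum>j<\<kappa>. M i j * x j))"
      by (simp add: sum_distrib_left mult_ac)
    then show ?thesis using row unfolding bil_def by simp
  qed
  then have "\<exists>w. \<forall>i\<in>{..<\<kappa>}. \<forall>j\<in>{..<\<kappa>}. (\<Sum>k<card {..<\<kappa>} - 1. w i k * w j k) = M i j"
    using nonneg row y s
    by (intro gram_realization_null_vector[of "{..<\<kappa>}" M y s]) (auto simp: M_def E_commute)
  then obtain w where w: "\<And>i j. i < \<kappa> \<Longrightarrow> j < \<kappa> \<Longrightarrow> (\<Sum>k<\<kappa> - 1. w i k * w j k) = M i j"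
    by auto
  obtain P :: "(nat \<times> nat) set" and u F where P: "finite P" "card P = q * \<kappa> + r" "\<And>p. \<not> F p p"
    "\<And>p p'. p \<in> P \<Longrightarrow> p' \<in> P \<Longrightarrow> (\<Sum>k<q * (\<kappa> - 1) + r. u p k * u p' k) = lam * of_bool (p = p') - of_bool (F p p')"
    using block_vectors[where lam = lam and E = E and \<kappa> = \<kappa> and m = "\<kappa> - 1" and w = w and q = q and r = r]
      lam_nonneg E_irrefl w unfolding M_def by blast
  show ?thesis
    using lines_of_graph_vectors[OF P(1) \<alpha> lam P(3,4)] P(2) by simp
qed

text \<open>
  The matrix (1 - \<alpha>)I + \<alpha>J is positive definite.
\<close>

lemma at_least_dimension_lines:
  assumes \<alpha>: "0 < \<alpha>" "\<alpha> < 1"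
  shows "\<exists>L. finite L \<and> card L = d \<and> equiangular_lines d (arccos \<alpha>) L"
proof -
  define M :: "nat \<Rightarrow> nat \<Rightarrow> real" where "M i j = (1 - \<alpha>) * of_bool (i = j) + \<alpha>" for i j
  have "(\<Sum>i<d. \<Sum>j<d. M i j * x i * x j) = (1 - \<alpha>) * (\<Sum>i<d. (x i)\<^sup>2) + \<alpha> * (\<Sum>i<d. x i)\<^sup>2" for x
  proof -
    have "(\<Sum>j<d. of_bool (i = j) * x i * x j) = (x i)\<^sup>2" if "i < d" for i
      using that by (simp add: of_bool_def if_distrib[of "\<lambda>c. c * _"] power2_eq_square cong: if_cong)
    then have "(\<Sum>i<d. \<Sum>j<d. of_bool (i = j) * x i * x j) = (\<Sum>i<d. (x i)\<^sup>2)" by simp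
    then show ?thesis
      unfolding M_def power2_eq_square[of "sum x {..<d}"] sum_product
      by (simp add: distrib_right sum.distrib mult.assoc flip: sum_distrib_left)
  qed
  then have "\<exists>w. \<forall>i\<in>{..<d}. \<forall>j\<in>{..<d}. (\<Sum>k<card {..<d}. w i k * w j k) = M i j"
    using \<alpha> by (intro gram_realization) (auto simp: M_def sum_nonneg)
  then obtain w where w: "\<And>i j. i < d \<Longrightarrow> j < d \<Longrightarrow> (\<Sum>k<d. w i k * w j k) = M i j" by auto
  have "\<exists>L. finite L \<and> card L = card {..<d} \<and> equiangular_lines d (arccos \<alpha>) L"
    using \<alpha> w by (intro lines_of_vectors[where u = w]) (auto simp: M_def)
  then show ?thesis by simp
qed

section \<open>Bounding the number of equiangular lines\<close>

text \<open>
  Unit vectors on equiangular lines, given by their coordinates. Joining the vectors with negative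
  inner product turns them into a graph with parameter \<open>lam\<close>.
\<close>

locale unit_system =
  fixes I :: "'i set" and d :: nat and \<alpha> :: real and w :: "'i \<Rightarrow> nat \<Rightarrow> real"
  assumes finI: "finite I" and alpha: "0 < \<alpha>" "\<alpha> < 1"
    and unit: "l \<in> I \<Longrightarrow> (\<Sum>k<d. w l k * w l k) = 1"
    and angle: "l \<in> I \<Longrightarrow> m \<in> I \<Longrightarrow> l \<noteq> m \<Longrightarrow> \<bar>\<Sum>k<d. w l k * w m k\<bar> = \<alpha>"
begin

definition lam :: real where
  "lam = (1 - \<alpha>) / (2 * \<alpha>)"

definition obtuse :: "'i \<Rightarrow> 'i \<Rightarrow> bool" where
  "obtuse l m \<longleftrightarrow> l \<noteq> m \<and> (\<Sum>k<d. w l k * w m k) < 0"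

lemma dot_eq:
  assumes "l \<in> I" "m \<in> I"
  shows "(\<Sum>k<d. w l k * w m k) = 2 * \<alpha> * (lam * of_bool (l = m) - of_bool (obtuse l m) + 1 / 2)"
  using assms unit angle[of l m] alpha unfolding obtuse_def lam_def
  by (auto simp: field_simps abs_if split: if_splits)

sublocale shifted_graph I obtuse lam
  by unfold_locales (use finI alpha in \<open>auto simp: obtuse_def lam_def mult.commute\<close>)

lemma gram_form:
  "(\<Sum>k<d. (\<Sum>l\<in>I. x l * w l k)\<^sup>2) = 2 * \<alpha> * (form x + (\<Sum>l\<in>I. x l)\<^sup>2 / 2)"
proof -
  have diag: "(\<Sum>m\<in>I. lam * of_bool (l = m) * (x l * x m)) = lam * (x l)\<^sup>2" if "l \<in> I" for l
  proof -
    have "(\<Sum>m\<in>I. lam * of_bool (l = m) * (x l * x m)) = (\<Sum>m\<in>I. if l = m then lam * (x l)\<^sup>2 else 0)"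
      by (intro sum.cong) (auto simp: power2_eq_square)
    then show ?thesis using that finI by simp
  qed
  have "(\<Sum>k<d. (\<Sum>l\<in>I. x l * w l k)\<^sup>2) = (\<Sum>k<d. \<Sum>l\<in>I. \<Sum>m\<in>I. (x l * x m) * (w l k * w m k))"
    unfolding power2_eq_square sum_product by (simp add: mult_ac)
  also have "\<dots> = (\<Sum>l\<in>I. \<Sum>m\<in>I. \<Sum>k<d. (x l * x m) * (w l k * w m k))"
    by (subst sum.swap) (intro sum.cong refl sum.swap)
  also have "\<dots> = (\<Sum>l\<in>I. \<Sum>m\<in>I. 2 * \<alpha> * (lam * of_bool (l = m) * (x l * x m) - of_bool (obtuse l m) * x l * x m + x l * x m / 2))"
  proof (intro sum.cong refl)
    fix l m assume lm: "l \<in> I" "m \<in> I"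
    show "(\<Sum>k<d. (x l * x m) * (w l k * w m k))
        = 2 * \<alpha> * (lam * of_bool (l = m) * (x l * x m) - of_bool (obtuse l m) * x l * x m + x l * x m / 2)"
      unfolding sum_distrib_left[symmetric] dot_eq[OF lm] by (simp add: algebra_simps)
  qed
  also have "\<dots> = 2 * \<alpha> * ((\<Sum>l\<in>I. \<Sum>m\<in>I. lam * of_bool (l = m) * (x l * x m))
      - (\<Sum>l\<in>I. \<Sum>m\<in>I. of_bool (obtuse l m) * x l * x m) + (\<Sum>l\<in>I. \<Sum>m\<in>I. x l * x m / 2))"
    unfolding sum_distrib_left[symmetric] sum.distrib sum_subtractf ..
  also have "(\<Sum>l\<in>I. \<Sum>m\<in>I. lam * of_bool (l = m) * (x l * x m)) = lam * (\<Sum>l\<in>I. (x l)\<^sup>2)"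
    unfolding sum_distrib_left using diag by (intro sum.cong) auto
  also have "(\<Sum>l\<in>I. \<Sum>m\<in>I. x l * x m / 2) = (\<Sum>l\<in>I. x l)\<^sup>2 / 2"
    unfolding power2_eq_square sum_product by (simp add: sum_divide_distrib)
  finally show ?thesis unfolding form_expand .
qed

sublocale equiangular_graph I obtuse lam
proof unfold_locales
  fix x
  have "0 \<le> 2 * \<alpha> * (form x + (\<Sum>l\<in>I. x l)\<^sup>2 / 2)"
    unfolding gram_form[symmetric] by (simp add: sum_nonneg)
  then show "0 \<le> form x + (\<Sum>l\<in>I. x l)\<^sup>2 / 2"
    using alpha by (simp add: zero_le_mult_iff)
qed

text \<open>
  If there were more lines than d plus the size of U, some nonzero x that vanishes on U would satisfy
  the d equations saying that the combination of the unit vectors with coefficients x is zero.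
\<close>

lemma card_le_of_determining:
  assumes U: "U \<subseteq> I"
    and det: "\<And>x. form x + (\<Sum>l\<in>I. x l)\<^sup>2 / 2 = 0 \<Longrightarrow> \<forall>u\<in>U. x u = 0 \<Longrightarrow> \<forall>u\<in>I. x u = 0"
  shows "card I \<le> d + card U"
proof (rule ccontr)
  assume less: "\<not> card I \<le> d + card U"
  have finU: "finite U" using U finI finite_subset by blast
  define J :: "(nat + 'i) set" where "J = Inl ` {..<d} \<union> Inr ` U"
  define f where "f j l = (case j of Inl k \<Rightarrow> w l k | Inr u \<Rightarrow> of_bool (l = u))" for j l
  have "card J = d + card U"
    unfolding J_def using finU by (subst card_Un_disjoint) (auto simp: card_image)
  moreover have "finite J" unfolding J_def using finU by simp
  ultimately obtain x where x: "\<exists>l\<in>I. x l \<noteq> 0" "\<forall>j\<in>J. (\<Sum>l\<in>I. f j l * x l) = 0"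
    using nonzero_solution[of J I f] finI less by auto
  have "(\<Sum>l\<in>I. x l * w l k) = 0" if "k < d" for k
    using x(2)[rule_format, of "Inl k"] that unfolding J_def f_def by (simp add: mult.commute)
  then have "2 * \<alpha> * (form x + (\<Sum>l\<in>I. x l)\<^sup>2 / 2) = 0"
    unfolding gram_form[symmetric] by simp
  then have "form x + (\<Sum>l\<in>I. x l)\<^sup>2 / 2 = 0" using alpha by simp
  moreover have "x u = 0" if "u \<in> U" for u
  proof -
    have "(\<Sum>l\<in>I. of_bool (l = u) * x l) = 0"
      using x(2)[rule_format, of "Inr u"] that unfolding J_def f_def by simp
    moreover have "(\<Sum>l\<in>I. of_bool (l = u) * x l) = (\<Sum>l\<in>I. if l = u then x u else 0)"
      by (intro sum.cong) auto
    ultimately show ?thesis using that U finI by auto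
  qed
  ultimately show False using det x(1) by blast
qed

text \<open>
  This combines the determining sets: in the first alternative the form takes negative
  values or no component carries a null vector, and in the second m is the number of components
  that carry one.
\<close>

lemma card_le_of_degree:
  assumes deg: "\<And>v. v \<in> I \<Longrightarrow> card (nbrs v) < 25"
    and lam: "lam \<le> l0" and n: "3 * (1 / sqrt 2) * (1 / 2) ^ n < 3 / sqrt 2 - l0"
  shows "card I \<le> d + (75 * (n + 1) + 4 * 25 ^ n + 1) \<or>
    (\<exists>\<kappa> m. spectral_radius_order lam = enat \<kappa> \<and> card I + 1 \<le> d + m \<and> m * \<kappa> \<le> card I)"
proof (cases "\<exists>z. form z < 0")
  case True
  then obtain z where "form z < 0" by blast
  have "\<exists>U\<subseteq>I. card U \<le> 75 * (n + 1) + 4 * 25 ^ n + 1 \<and>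
    (\<forall>x. form x \<le> 0 \<longrightarrow> (\<forall>u\<in>U. x u = 0) \<longrightarrow> (\<forall>u\<in>I. x u = 0))"
  proof (cases "\<exists>a. spider n a")
    case True
    then obtain a where "spider n a" by blast
    from determining_set_of_spider[OF this lam n deg] obtain U where "U \<subseteq> I"
      "card U \<le> 3 * (n + 1) * 25" "\<forall>x. form x \<le> 0 \<longrightarrow> (\<forall>u\<in>U. x u = 0) \<longrightarrow> (\<forall>u\<in>I. x u = 0)"
      by blast
    then show ?thesis by (intro exI[of _ U]) auto
  next
    case False
    from determining_set_of_layers[OF False deg \<open>form z < 0\<close>] obtain U where "U \<subseteq> I"
      "card U \<le> 4 * 25 ^ n + 1" "\<forall>x. form x \<le> 0 \<longrightarrow> (\<forall>u\<in>U. x u = 0) \<longrightarrow> (\<forall>u\<in>I. x u = 0)"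
      by blast
    then show ?thesis by (intro exI[of _ U]) auto
  qed
  then obtain U where U: "U \<subseteq> I" "card U \<le> 75 * (n + 1) + 4 * 25 ^ n + 1"
    "\<And>x. form x \<le> 0 \<Longrightarrow> \<forall>u\<in>U. x u = 0 \<Longrightarrow> \<forall>u\<in>I. x u = 0" by blast
  have "card I \<le> d + card U"
  proof (rule card_le_of_determining[OF U(1)])
    fix x assume x: "form x + (\<Sum>l\<in>I. x l)\<^sup>2 / 2 = 0" "\<forall>u\<in>U. x u = 0"
    have "0 \<le> (\<Sum>l\<in>I. x l)\<^sup>2" by simp
    then have "form x \<le> 0" using x(1) by linarith
    then show "\<forall>u\<in>I. x u = 0" using U(3) x(2) by blast
  qed
  then show ?thesis using U(2) by linarith
next
  case False
  then have nonneg: "0 \<le> form x" for x by (simp add: not_less)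
  from determining_set_of_nonneg[OF nonneg] obtain U where U: "U \<subseteq> I" "card U \<le> card null_components - 1"
    "\<And>x. form x = 0 \<Longrightarrow> (\<Sum>u\<in>I. x u) = 0 \<Longrightarrow> \<forall>u\<in>U. x u = 0 \<Longrightarrow> \<forall>u\<in>I. x u = 0"
    by blast
  have card: "card I \<le> d + card U"
  proof (rule card_le_of_determining[OF U(1)])
    fix x assume x: "form x + (\<Sum>l\<in>I. x l)\<^sup>2 / 2 = 0" "\<forall>u\<in>U. x u = 0"
    have "0 \<le> (\<Sum>l\<in>I. x l)\<^sup>2" by simp
    then have "form x = 0" "(\<Sum>l\<in>I. x l)\<^sup>2 = 0" using x(1) nonneg[of x] by linarith+
    then show "\<forall>u\<in>I. x u = 0" using U(3) x(2) by simp
  qed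
  show ?thesis
  proof (cases "null_components = {}")
    case True
    then show ?thesis using card U(2) by simp
  next
    case False
    then obtain C where "C \<in> null_components" by blast
    have ord: "spectral_radius_order lam \<le> enat (card C)" if "C \<in> null_components" for C
      by (rule null_component_order[OF nonneg that])
    then obtain \<kappa> where \<kappa>: "spectral_radius_order lam = enat \<kappa>"
      using \<open>C \<in> null_components\<close> by (meson enat_ile)
    have "card null_components * \<kappa> \<le> card I"
      using ord \<kappa> by (intro card_null_components) simp
    moreover have "0 < card null_components"
      using False finite_null_components by (simp add: card_gt_0_iff)
    then have "card I + 1 \<le> d + card null_components"
      using card U(2) by linarith
    ultimately show ?thesis using \<kappa> by blast
  qed
qed

lemma switch:
  "unit_system I d \<alpha> (\<lambda>l k. (if l \<in> F then - w l k else w l k))"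
proof unfold_locales
  fix l m assume lm: "l \<in> I" "m \<in> I" "l \<noteq> m"
  have "(\<Sum>k<d. (if l \<in> F then - w l k else w l k) * (if m \<in> F then - w m k else w m k))
      = (if l \<in> F \<longleftrightarrow> m \<in> F then 1 else - 1) * (\<Sum>k<d. w l k * w m k)"
    by (auto simp: sum_negf)
  then show "\<bar>\<Sum>k<d. (if l \<in> F then - w l k else w l k) * (if m \<in> F then - w m k else w m k)\<bar> = \<alpha>"
    using angle[OF lm] by (auto simp: abs_mult)
next
  fix l assume "l \<in> I"
  have "(\<Sum>k<d. (if l \<in> F then - w l k else w l k) * (if l \<in> F then - w l k else w l k)) = (\<Sum>k<d. w l k * w l k)"
    by (auto intro!: sum.cong)
  then show "(\<Sum>k<d. (if l \<in> F then - w l k else w l k) * (if l \<in> F then - w l k else w l k)) = 1"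
    using unit[OF \<open>l \<in> I\<close>] by simp
qed (use finI alpha in auto)

lemma obtuse_switch:
  assumes "l \<in> I" "m \<in> I"
  shows "unit_system.obtuse d (\<lambda>l k. (if l \<in> F then - w l k else w l k)) l m \<longleftrightarrow>
    l \<noteq> m \<and> (obtuse l m \<longleftrightarrow> (l \<in> F \<longleftrightarrow> m \<in> F))"
proof -
  interpret S: unit_system I d \<alpha> "\<lambda>l k. (if l \<in> F then - w l k else w l k)" by (rule switch)
  have "(\<Sum>k<d. (if l \<in> F then - w l k else w l k) * (if m \<in> F then - w m k else w m k))
      = (if l \<in> F \<longleftrightarrow> m \<in> F then 1 else - 1) * (\<Sum>k<d. w l k * w m k)"
    by (auto simp: sum_negf)
  moreover have "(\<Sum>k<d. w l k * w m k) \<noteq> 0" if "l \<noteq> m"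
    using angle[OF assms that] alpha by auto
  ultimately show ?thesis
    unfolding S.obtuse_def obtuse_def by (auto simp: not_less less_le)
qed

end

text \<open>
  It remains to reduce to bounded degree. Small systems are absorbed in the constant; in a large one
  Ramsey's theorem provides an independent set S, and the vectors that are obtuse to at least 25
  vectors of S are reversed.
\<close>

lemma card_unit_system_le:
  fixes l0 :: real
  assumes l0: "l0 < 3 / sqrt 2"
  shows "\<exists>C::nat. \<forall>(I :: 'i set) d \<alpha> w lam. unit_system I d \<alpha> w \<longrightarrow> lam = (1 - \<alpha>) / (2 * \<alpha>) \<longrightarrow> lam \<le> l0 \<longrightarrow>
    card I \<le> d + C \<or>
    (\<exists>\<kappa> m. spectral_radius_order lam = enat \<kappa> \<and> card I + 1 \<le> d + m \<and> m * \<kappa> \<le> card I)"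
proof -
  have "0 < (3 / sqrt 2 - l0) / (3 * (1 / sqrt 2))" using l0 by simp
  then obtain n where "(1 / 2) ^ n < (3 / sqrt 2 - l0) / (3 * (1 / sqrt 2))"
    using real_arch_pow_inv[of "(3 / sqrt 2 - l0) / (3 * (1 / sqrt 2))" "1 / 2"] by auto
  then have n: "3 * (1 / sqrt 2) * (1 / 2) ^ n < 3 / sqrt 2 - l0"
    by (subst (asm) pos_less_divide_eq) (auto simp: mult_ac)
  obtain R where R: "\<And>(V :: 'i set) E. finite V \<Longrightarrow> R \<le> card V \<Longrightarrow>
      \<exists>S\<subseteq>V. card S = 9 \<and> clique S E \<or> card S = 626 \<and> indep S E"
    using ramsey2[of 9 626, where ?'a = 'i] by blast
  have "(3 / sqrt 2) \<le> 3" by (simp add: field_simps)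
  then have l3: "l0 < 3" using l0 by linarith
  have bound: "card I \<le> d + (R + (75 * (n + 1) + 4 * 25 ^ n + 1)) \<or>
    (\<exists>\<kappa> m. spectral_radius_order (unit_system.lam \<alpha>) = enat \<kappa> \<and> card I + 1 \<le> d + m \<and> m * \<kappa> \<le> card I)"
    if "unit_system I d \<alpha> w" "unit_system.lam \<alpha> \<le> l0" for I :: "'i set" and d \<alpha> w
  proof (cases "card I \<le> R")
    case False
    interpret unit_system I d \<alpha> w by fact
    have lam3: "lam \<le> 3" using that(2) l3 by linarith
    define T where "T = {{u, v} | u v. obtuse u v}"
    have T: "{u, v} \<in> T \<longleftrightarrow> obtuse u v" for u v
      unfolding T_def using E_commute by (auto simp: doubleton_eq_iff)
    obtain S where S: "S \<subseteq> I" "card S = 9 \<and> clique S T \<or> card S = 626 \<and> indep S T"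
      using R[of I T] finI False by auto
    have "\<not> (card S = 9 \<and> clique S T)"
      using clique_card_le[OF S(1)] lam3 l3 that(2) T unfolding clique_def by fastforce
    then have S626: "card S = 626" "indep S T" using S(2) by auto
    have "\<forall>u\<in>S. \<forall>v\<in>S. u \<noteq> v \<longrightarrow> \<not> obtuse u v"
      using S626(2) unfolding indep_def T .
    then have indep: "\<not> obtuse u v" if "u \<in> S" "v \<in> S" for u v
      using that by (cases "u = v") (simp_all add: E_irrefl)
    \<comment> \<open>the vectors to be reversed\<close>
    define F where "F = {v \<in> I - S. 25 \<le> card (S \<inter> nbrs v)}"
    interpret S: unit_system I d \<alpha> "\<lambda>l k. (if l \<in> F then - w l k else w l k)" by (rule switch)
    have sw: "S.obtuse l m \<longleftrightarrow> l \<noteq> m \<and> (obtuse l m \<longleftrightarrow> (l \<in> F \<longleftrightarrow> m \<in> F))" if "l \<in> I" "m \<in> I" for l m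
      by (rule obtuse_switch[OF that])
    have FS: "F \<inter> S = {}" unfolding F_def by auto
    have indepS: "\<not> S.obtuse u v" if "u \<in> S" "v \<in> S" for u v
      using sw[of u v] indep[OF that] that S(1) FS by blast
    have few: "card (S \<inter> S.nbrs v) < 25" if v: "v \<in> I" for v
    proof -
      consider "v \<in> S" | "v \<in> F" | "v \<notin> S" "v \<notin> F" by blast
      then show ?thesis
      proof cases
        case 1
        then have "S \<inter> S.nbrs v = {}" using indepS unfolding S.nbrs_def by auto
        then show ?thesis by simp
      next
        case 2
        then have vF: "v \<notin> S" "25 \<le> card (S \<inter> nbrs v)" unfolding F_def by auto
        have "S \<inter> S.nbrs v = S - nbrs v"
          using 2 sw[OF v] FS S(1) vF(1) unfolding S.nbrs_def nbrs_def by blast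
        then show ?thesis
          using not_both_large[OF lam3 S(1) indep v vF] by simp
      next
        case 3
        have "S \<inter> S.nbrs v = S \<inter> nbrs v"
          using 3 sw[OF v] FS S(1) E_irrefl unfolding S.nbrs_def nbrs_def by blast
        then show ?thesis using 3 v unfolding F_def by auto
      qed
    qed
    have "card (S.nbrs v) < 25" if "v \<in> I" for v
      using S.degree_less_25[OF lam3 S(1) indepS _ few that] S626(1) by simp
    from S.card_le_of_degree[OF this that(2) n] show ?thesis by auto
  qed simp
  show ?thesis
  proof (intro exI allI impI)
    fix I :: "'i set" and d \<alpha> w lam
    assume "unit_system I d \<alpha> w" "lam = (1 - \<alpha>) / (2 * \<alpha>)" "lam \<le> l0"
    then show "card I \<le> d + (R + (75 * (n + 1) + 4 * 25 ^ n + 1)) \<or>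
      (\<exists>\<kappa> m. spectral_radius_order lam = enat \<kappa> \<and> card I + 1 \<le> d + m \<and> m * \<kappa> \<le> card I)"
      using bound[of I d \<alpha> w] unit_system.lam_def by metis
  qed
qed

lemma unit_system_of_lines:
  assumes \<alpha>: "0 < \<alpha>" "\<alpha> < 1" and L: "finite L" "equiangular_lines d (arccos \<alpha>) L"
  shows "\<exists>w. unit_system L d \<alpha> w"
proof -
  have ex: "\<exists>u. u \<in> l \<and> u \<in> carrier_vec d \<and> scalar_prod u u = 1" if l: "l \<in> L" for l
  proof -
    obtain v where v: "v \<in> carrier_vec d" "v \<noteq> 0\<^sub>v d" "l = range (\<lambda>c. c \<cdot>\<^sub>v v)"
      using L(2) l unfolding equiangular_lines_def lines_through_origin_def line_through_def by blast
    obtain j where j: "j < d" "v $ j \<noteq> 0"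
      using v(1,2) by (metis carrier_vecD eq_vecI index_zero_vec)
    have "scalar_prod v v = (\<Sum>k<d. (v $ k)\<^sup>2)"
      using v(1) by (simp add: scalar_prod_def atLeast0LessThan power2_eq_square)
    also have "\<dots> > 0" using j by (intro sum_pos2[of _ j]) auto
    finally have pos: "0 < scalar_prod v v" .
    let ?u = "(1 / sqrt (scalar_prod v v)) \<cdot>\<^sub>v v"
    have "scalar_prod ?u ?u = 1"
      using v(1) pos by (simp add: field_simps)
    then show ?thesis using v by (intro exI[of _ ?u]) auto
  qed
  then obtain u where u: "\<And>l. l \<in> L \<Longrightarrow> u l \<in> l" "\<And>l. l \<in> L \<Longrightarrow> u l \<in> carrier_vec d"
    "\<And>l. l \<in> L \<Longrightarrow> scalar_prod (u l) (u l) = 1"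
    by metis
  define w where "w l k = u l $ k" for l k
  have dot: "(\<Sum>k<d. w l k * w m k) = scalar_prod (u l) (u m)" if "m \<in> L" for l m
    using u(2)[OF that] by (simp add: w_def scalar_prod_def atLeast0LessThan)
  have "unit_system L d \<alpha> w"
  proof unfold_locales
    fix l m assume lm: "l \<in> L" "m \<in> L" "l \<noteq> m"
    let ?p = "scalar_prod (u l) (u m)"
    have "(\<Sum>k<d. w l k * w m k)\<^sup>2 \<le> (\<Sum>k<d. (w l k)\<^sup>2) * (\<Sum>k<d. (w m k)\<^sup>2)"
      by (rule Cauchy_Schwarz_ineq_sum)
    also have "\<dots> = 1"
      using dot u(3) lm by (simp add: power2_eq_square)
    finally have "\<bar>?p\<bar> \<le> 1"
      unfolding dot[OF lm(2)] by (simp add: abs_square_le_1)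
    moreover have "\<forall>y\<in>l. \<forall>z\<in>m. scalar_prod y y = 1 \<longrightarrow> scalar_prod z z = 1 \<longrightarrow>
        arccos \<bar>scalar_prod y z\<bar> = arccos \<alpha>"
      using L(2) lm unfolding equiangular_lines_def by simp
    then have "arccos \<bar>?p\<bar> = arccos \<alpha>"
      using u(1,3) lm by simp
    ultimately have "\<bar>?p\<bar> = \<alpha>"
      using arccos_eq_iff[of "\<bar>?p\<bar>" \<alpha>] \<alpha> by simp
    then show "\<bar>\<Sum>k<d. w l k * w m k\<bar> = \<alpha>" using dot lm by simp
  qed (use u dot \<alpha> L in auto)
  then show ?thesis by blast
qed

section \<open>The maximum number of equiangular lines\<close>

theorem theorem2:
  fixes lam0 :: real
  assumes "lam0 < 3 / sqrt 2"
  shows "\<exists>C C' :: real. \<forall>\<alpha> lam :: real.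
    0 < \<alpha> \<longrightarrow> \<alpha> < 1 \<longrightarrow> lam = (1 - \<alpha>) / (2 * \<alpha>) \<longrightarrow> lam \<le> lam0 \<longrightarrow>
      (\<forall>\<kappa> :: nat. spectral_radius_order lam = enat \<kappa> \<longrightarrow>
        (\<forall>d :: nat. d > 0 \<longrightarrow> real d > C * real \<kappa> \<longrightarrow>
          int (max_equiangular \<alpha> d) = \<lfloor>(real d - 1) * real \<kappa> / (real \<kappa> - 1)\<rfloor>)) \<and>
      (spectral_radius_order lam = \<infinity> \<longrightarrow>
        (\<forall>d :: nat. d > 0 \<longrightarrow> \<bar>real (max_equiangular \<alpha> d) - real d\<bar> \<le> C'))"
proof -
  from card_unit_system_le[OF assms, where ?'i = "real vec set"] obtain C where
    C: "\<And>I d \<alpha> w lam. unit_system (I :: real vec set set) d \<alpha> w \<Longrightarrow> lam = (1 - \<alpha>) / (2 * \<alpha>) \<Longrightarrow> lam \<le> lam0 \<Longrightarrow>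
      card I \<le> d + C \<or>
      (\<exists>\<kappa> m. spectral_radius_order lam = enat \<kappa> \<and> card I + 1 \<le> d + m \<and> m * \<kappa> \<le> card I)"
    by blast
  show ?thesis
  proof (intro exI[of _ "real (C + 1)"] allI impI conjI)
    fix \<alpha> lam :: real and \<kappa> d :: nat
    assume \<alpha>: "0 < \<alpha>" "\<alpha> < 1" and lam: "lam = (1 - \<alpha>) / (2 * \<alpha>)" "lam \<le> lam0"
      and \<kappa>: "spectral_radius_order lam = enat \<kappa>" and d: "0 < d" "real d > real (C + 1) * real \<kappa>"
    have "0 < lam" using lam(1) \<alpha> by simp
    then have k2: "2 \<le> \<kappa>" using spectral_radius_order_witness[OF \<kappa>] by blast
    have dC: "(C + 1) * \<kappa> < d"
      using d(2) by (metis of_nat_less_iff of_nat_mult)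
    define q r N where "q = (d - 1) div (\<kappa> - 1)" and "r = (d - 1) mod (\<kappa> - 1)" and "N = q * \<kappa> + r"
    have qr: "q * (\<kappa> - 1) + r = d - 1" unfolding q_def r_def by (rule div_mult_mod_eq)
    \<comment> \<open>the number of lines obtained from q copies of the graph on \<open>\<kappa>\<close> vertices and r isolated vertices\<close>
    have N: "N = (d - 1) + q"
      using qr k2 unfolding N_def by (cases \<kappa>) auto
    have N_div: "N = (d - 1) * \<kappa> div (\<kappa> - 1)"
    proof -
      have "(d - 1) * \<kappa> = (d - 1) + (d - 1) * (\<kappa> - 1)"
        using k2 by (cases \<kappa>) auto
      then show ?thesis
        using k2 unfolding N q_def by (simp del: mult_Suc_right)
    qed
    obtain L where L: "finite L" "card L = N" "equiangular_lines (Suc (q * (\<kappa> - 1) + r)) (arccos \<alpha>) L"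
      using many_lines[OF \<alpha> lam(1) \<kappa>, of q r] unfolding N_def by blast
    have mem: "N \<in> {card L | L. finite L \<and> equiangular_lines d (arccos \<alpha>) L}"
      using L d(1) unfolding qr by auto
    have upper: "card L \<le> N" if L: "finite L" "equiangular_lines d (arccos \<alpha>) L" for L
    proof -
      obtain w where "unit_system L d \<alpha> w" using unit_system_of_lines[OF \<alpha> L] by blast
      from C[OF this lam] have "card L * (\<kappa> - 1) \<le> (d - 1) * \<kappa>"
      proof
        assume le: "card L \<le> d + C"
        obtain k where k: "\<kappa> = Suc k" using k2 by (cases \<kappa>) auto
        obtain e where e: "d = Suc e" using d(1) by (cases d) auto
        have "card L * k \<le> (d + C) * k" using le by simp
        also have "\<dots> \<le> e * Suc k"
          using dC unfolding k e by (simp add: algebra_simps)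
        finally show ?thesis unfolding k e by simp
      next
        assume "\<exists>\<kappa>' m. spectral_radius_order lam = enat \<kappa>' \<and> card L + 1 \<le> d + m \<and> m * \<kappa>' \<le> card L"
        then obtain m where m: "card L + 1 \<le> d + m" "m * \<kappa> \<le> card L" using \<kappa> by auto
        have "card L \<le> (d - 1) + m" using m(1) d(1) by simp
        then have "card L * \<kappa> \<le> (d - 1) * \<kappa> + m * \<kappa>"
          by (metis add_mult_distrib mult_le_mono1)
        then have "card L * \<kappa> \<le> (d - 1) * \<kappa> + card L" using m(2) by linarith
        then show ?thesis by (simp add: diff_mult_distrib2)
      qed
      then show ?thesis
        unfolding N_div using k2 by (simp add: less_eq_div_iff_mult_less_eq)
    qed
    have "max_equiangular \<alpha> d = N"
      unfolding max_equiangular_def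
    proof (rule Max_eqI[OF _ _ mem])
      show "finite {card L | L. finite L \<and> equiangular_lines d (arccos \<alpha>) L}"
        by (rule finite_subset[of _ "{..N}"]) (use upper in auto)
    qed (use upper in auto)
    moreover have "\<lfloor>(real d - 1) * real \<kappa> / (real \<kappa> - 1)\<rfloor> = int N"
    proof -
      have "(real d - 1) * real \<kappa> / (real \<kappa> - 1) = real ((d - 1) * \<kappa>) / real (\<kappa> - 1)"
        using d(1) k2 by (simp add: of_nat_diff)
      then show ?thesis unfolding N_div by (simp only: floor_divide_of_nat_eq)
    qed
    ultimately show "int (max_equiangular \<alpha> d) = \<lfloor>(real d - 1) * real \<kappa> / (real \<kappa> - 1)\<rfloor>" by simp
  next
    fix \<alpha> lam :: real and d :: nat
    assume \<alpha>: "0 < \<alpha>" "\<alpha> < 1" and lam: "lam = (1 - \<alpha>) / (2 * \<alpha>)" "lam \<le> lam0"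
      and inf: "spectral_radius_order lam = \<infinity>"
    let ?S = "{card L | L. finite L \<and> equiangular_lines d (arccos \<alpha>) L}"
    have upper: "card L \<le> d + C" if L: "finite L" "equiangular_lines d (arccos \<alpha>) L" for L
    proof -
      obtain w where "unit_system L d \<alpha> w" using unit_system_of_lines[OF \<alpha> L] by blast
      from C[OF this lam] show ?thesis using inf by simp
    qed
    have fin: "finite ?S"
      by (rule finite_subset[of _ "{..d + C}"]) (use upper in auto)
    have d: "d \<in> ?S" using at_least_dimension_lines[OF \<alpha>, of d] by auto
    have "d \<le> max_equiangular \<alpha> d"
      unfolding max_equiangular_def by (rule Max_ge[OF fin d])
    moreover have "max_equiangular \<alpha> d \<in> ?S"
      unfolding max_equiangular_def using d by (intro Max_in fin) auto
    then have "max_equiangular \<alpha> d \<le> d + C" using upper by auto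
    ultimately show "\<bar>real (max_equiangular \<alpha> d) - real d\<bar> \<le> real (C + 1)" by simp
  qed
qed

end
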